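(* Let $(\Gamma,\mu)$ be a weighted graph that satisfies $(p_0)$ and $(\overline{E})$ and is very strongly recurrent. Then there are constants $Q,c,C>0$ such that, with $l_9$ defined using this $Q$, for all $x,y\in\Gamma$ and all integers $n\ge d(x,y)$, writing $d=d(x,y)$, $$\widetilde{p}_n(x,y)\ge\frac{c}{V(x,e(x,n))}\exp\left[-C\,l_9\left(x,y,\tfrac12 n,d\right)\right].$$
   Context: $\Gamma$ is an infinite connected graph without loops or multiple edges; $x\sim y$ denotes adjacency. A symmetric weight $\mu_{x,y}=\mu_{y,x}>0$ is given on the edges; $\mu(x)=\sum_{y\sim x}\mu_{x,y}$ (finite), $\mu(A)=\sum_{y\in A}\mu(y)$. $(X_n)$ is the random walk on $\Gamma$ with transition probabilities $P(x,y)=\mu_{x,y}/\mu(x)$ for $x\sim y$ and $0$ otherwise; $\mathbb{P}_x,\mathbb{E}_x$ are probability and expectation for $X_0=x$. The heat kernel is $p_n(x,y)=\mathbb{P}_x(X_n=y)/\mu(y)$, and $\widetilde{p}_n(x,y)=p_n(x,y)+p_{n+1}(x,y)$. Condition $(p_0)$: there is $p_0>0$ with $P(x,y)\ge p_0$ for all $x\sim y$. $d$ is the shortest-path graph distance, $B(x,R)=\{y:d(x,y)<R\}$, $V(x,R)=\mu(B(x,R))$. For $A\subset\Gamma$, $\partial A$ is the set of vertices outside $A$ adjacent to a vertex of $A$; $T_A=\inf\{t\ge0:X_t\in\Gamma\setminus A\}$ is the exit time and $\tau_A=T_{\Gamma\setminus A}$ the hitting time. Write $T_{x,R}=T_{B(x,R)}$,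 $\tau_x=\tau_{\{x\}}$, $E_y(x,R)=\mathbb{E}_y(T_{B(x,R)})$, $E(x,R)=E_x(x,R)$ (so $E(x,0)=0$), $\overline{E}(x,R)=\max_{y\in B(x,R)}E_y(x,R)$. Condition $(\overline{E})$: there is $C>0$ with $\overline{E}(x,R)\le C\,E(x,R)$ for all $x\in\Gamma$, $R>0$. The graph is very strongly recurrent if there is $c>0$ such that for all $x\in\Gamma$, all integers $r\ge1$ and all $w\in\partial B(x,r)$, $\mathbb{P}_w(\tau_x<T_{x,2r})\ge c$. $e(x,n)=\min\{r\in\{1,2,\dots\}:E(x,r)\ge n\}$. $\pi_{x,y}$ is the set of all vertices lying on some shortest path from $x$ to $y$. For a constant $Q>0$ and real $s\ge 0$, $R\ge 0$: $l_9(x,y,s,R)$ is the minimal integer $l\ge1$ for which $\frac{s}{l}\ge Q\max_{z\in\pi_{x,y}}E(z,\frac{9R}{l})$, and $l_9(x,y,s,R)=R$ if there is no such integer. *)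

theory Defs
  imports "HOL-Probability.Probability"
begin

section \<open>Weighted graphs\<close>

text \<open>The vertices are all elements of the type \<open>'a\<close>. The weight is only meaningful on edges.\<close>

record 'a wgraph =
  adj :: "'a \<Rightarrow> 'a \<Rightarrow> bool"
  weight :: "'a \<Rightarrow> 'a \<Rightarrow> real"

text \<open>A walk from \<open>x\<close> to \<open>y\<close> is the list of its vertices; it has \<open>length xs - 1\<close> edges.\<close>

definition walk_betw :: "'a wgraph \<Rightarrow> 'a \<Rightarrow> 'a list \<Rightarrow> 'a \<Rightarrow> bool" where
  "walk_betw G x xs y \<longleftrightarrow> xs \<noteq> [] \<and> hd xs = x \<and> last xs = y \<and> successively (adj G) xs"

locale weighted_graph =
  fixes G :: "'a wgraph"
  assumes infinite_vertices: "infinite (UNIV :: 'a set)"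
    and adj_irrefl: "\<not> adj G x x"
    and adj_sym: "adj G x y \<Longrightarrow> adj G y x"
    and connected: "\<exists>xs. walk_betw G x xs y"
    and weight_pos: "adj G x y \<Longrightarrow> weight G x y > 0"
    and weight_sym: "adj G x y \<Longrightarrow> weight G x y = weight G y x"
    and weight_summable: "weight G x summable_on {y. adj G x y}"

definition mu :: "'a wgraph \<Rightarrow> 'a \<Rightarrow> real" where
  "mu G x = (\<Sum>\<^sub>\<infinity>y\<in>{y. adj G x y}. weight G x y)"

definition mu_set :: "'a wgraph \<Rightarrow> 'a set \<Rightarrow> real" where
  "mu_set G A = (\<Sum>\<^sub>\<infinity>y\<in>A. mu G y)"

definition gdist :: "'a wgraph \<Rightarrow> 'a \<Rightarrow> 'a \<Rightarrow> nat" where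
  "gdist G x y = (LEAST n. \<exists>xs. walk_betw G x xs y \<and> length xs = Suc n)"

definition gball :: "'a wgraph \<Rightarrow> 'a \<Rightarrow> real \<Rightarrow> 'a set" where
  "gball G x R = {y. real (gdist G x y) < R}"

definition vol :: "'a wgraph \<Rightarrow> 'a \<Rightarrow> real \<Rightarrow> real" where
  "vol G x R = mu_set G (gball G x R)"

definition boundary :: "'a wgraph \<Rightarrow> 'a set \<Rightarrow> 'a set" where
  "boundary G A = {z. z \<notin> A \<and> (\<exists>y\<in>A. adj G y z)}"

definition geodesic_hull :: "'a wgraph \<Rightarrow> 'a \<Rightarrow> 'a \<Rightarrow> 'a set" where
  "geodesic_hull G x y =
     \<Union> {set xs | xs. walk_betw G x xs y \<and> length xs = Suc (gdist G x y)}"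

section \<open>The random walk\<close>

definition trans_prob :: "'a wgraph \<Rightarrow> 'a \<Rightarrow> 'a \<Rightarrow> real" where
  "trans_prob G x y = (if adj G x y then weight G x y / mu G x else 0)"

definition step :: "'a wgraph \<Rightarrow> 'a \<Rightarrow> 'a measure" where
  "step G x = density (count_space UNIV) (\<lambda>y. ennreal (trans_prob G x y))"

definition rw_kernel :: "'a wgraph \<Rightarrow> 'a \<Rightarrow> nat \<Rightarrow> (nat \<Rightarrow> 'a) \<Rightarrow> 'a measure" where
  "rw_kernel G x n \<omega> =
     (case n of 0 \<Rightarrow> return (count_space UNIV) x | Suc k \<Rightarrow> step G (\<omega> k))"

text \<open>
  The law of the random walk started at \<open>x\<close> on the space of trajectories \<open>nat \<Rightarrow> 'a\<close>, obtained
  from the Ionescu-Tulcea theorem.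
\<close>

definition rw :: "'a wgraph \<Rightarrow> 'a \<Rightarrow> (nat \<Rightarrow> 'a) measure" where
  "rw G x = projective_family.lim UNIV
     (Ionescu_Tulcea.CI (rw_kernel G x) (\<lambda>_. count_space UNIV)) (\<lambda>_. count_space UNIV)"

definition heat_kernel :: "'a wgraph \<Rightarrow> nat \<Rightarrow> 'a \<Rightarrow> 'a \<Rightarrow> real" where
  "heat_kernel G n x y = measure (rw G x) {\<omega> \<in> space (rw G x). \<omega> n = y} / mu G y"

definition heat_kernel_sum :: "'a wgraph \<Rightarrow> nat \<Rightarrow> 'a \<Rightarrow> 'a \<Rightarrow> real" where
  "heat_kernel_sum G n x y = heat_kernel G n x y + heat_kernel G (Suc n) x y"

definition exit_time :: "'a set \<Rightarrow> (nat \<Rightarrow> 'a) \<Rightarrow> enat" where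
  "exit_time A \<omega> = (INF t\<in>{t. \<omega> t \<notin> A}. enat t)"

definition hit_time :: "'a set \<Rightarrow> (nat \<Rightarrow> 'a) \<Rightarrow> enat" where
  "hit_time A = exit_time (- A)"

definition mean_exit_from :: "'a wgraph \<Rightarrow> 'a \<Rightarrow> 'a \<Rightarrow> real \<Rightarrow> ennreal" where
  "mean_exit_from G y x R = (\<integral>\<^sup>+\<omega>. ennreal_of_enat (exit_time (gball G x R) \<omega>) \<partial>rw G y)"

definition mean_exit :: "'a wgraph \<Rightarrow> 'a \<Rightarrow> real \<Rightarrow> ennreal" where
  "mean_exit G x R = mean_exit_from G x x R"

text \<open>
  Balls and geodesic hulls are finite in the locally finite graphs considered, so the suprema here
  and in the definition of \<open>l9\<close> are maxima.
\<close>

definition max_mean_exit :: "'a wgraph \<Rightarrow> 'a \<Rightarrow> real \<Rightarrow> ennreal" where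
  "max_mean_exit G x R = (SUP y\<in>gball G x R. mean_exit_from G y x R)"

definition inv_exit :: "'a wgraph \<Rightarrow> 'a \<Rightarrow> nat \<Rightarrow> nat" where
  "inv_exit G x n = (LEAST r. r \<ge> 1 \<and> mean_exit G x (real r) \<ge> of_nat n)"

section \<open>The conditions on the graph\<close>

definition cond_p0 :: "'a wgraph \<Rightarrow> bool" where
  "cond_p0 G \<longleftrightarrow> (\<exists>p0>0. \<forall>x y. adj G x y \<longrightarrow> trans_prob G x y \<ge> p0)"

definition cond_Ebar :: "'a wgraph \<Rightarrow> bool" where
  "cond_Ebar G \<longleftrightarrow>
     (\<exists>C::real. C > 0 \<and> (\<forall>x. \<forall>R>0. max_mean_exit G x R \<le> ennreal C * mean_exit G x R))"

definition very_strongly_recurrent :: "'a wgraph \<Rightarrow> bool" where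
  "very_strongly_recurrent G \<longleftrightarrow>
     (\<exists>c>0. \<forall>x. \<forall>r::nat. r \<ge> 1 \<longrightarrow> (\<forall>w\<in>boundary G (gball G x (real r)).
        measure (rw G w)
          {\<omega> \<in> space (rw G w). hit_time {x} \<omega> < exit_time (gball G x (2 * real r)) \<omega>} \<ge> c))"

section \<open>The chaining length\<close>

definition l9_admissible :: "'a wgraph \<Rightarrow> real \<Rightarrow> 'a \<Rightarrow> 'a \<Rightarrow> real \<Rightarrow> real \<Rightarrow> nat \<Rightarrow> bool" where
  "l9_admissible G Q x y s R l \<longleftrightarrow> l \<ge> 1 \<and>
     ennreal (s / real l) \<ge>
       ennreal Q * (SUP z\<in>geodesic_hull G x y. mean_exit G z (9 * R / real l))"

definition l9 :: "'a wgraph \<Rightarrow> real \<Rightarrow> 'a \<Rightarrow> 'a \<Rightarrow> real \<Rightarrow> real \<Rightarrow> real" where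
  "l9 G Q x y s R =
     (if \<exists>l. l9_admissible G Q x y s R l then real (LEAST l. l9_admissible G Q x y s R l) else R)"

section \<open>The random walk is well defined\<close>

context weighted_graph
begin

lemma ex_neighbour: "\<exists>y. adj G x y"
proof -
  obtain z where z: "z \<noteq> x"
    using infinite_vertices by (metis ex_new_if_finite finite.emptyI finite_insert insertI1)
  obtain xs where xs: "walk_betw G x xs z" using connected by blast
  then obtain a as where [simp]: "xs = a # as" by (cases xs) (auto simp: walk_betw_def)
  from xs z show ?thesis
    by (cases as) (auto simp: walk_betw_def)
qed

lemma mu_pos: "mu G x > 0"
proof -
  obtain y where y: "adj G x y" using ex_neighbour by blast
  have "0 < weight G x y" using y by (rule weight_pos)
  also have "weight G x y = infsum (weight G x) {y}" by simp
  also have "\<dots> \<le> mu G x" unfolding mu_def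
    using y by (intro infsum_mono2) (auto intro: weight_summable less_imp_le weight_pos)
  finally show ?thesis .
qed

lemma prob_space_step: "prob_space (step G x)"
proof
  have "((\<lambda>y. weight G x y) has_sum mu G x) {y. adj G x y}"
    unfolding mu_def by (intro has_sum_infsum weight_summable)
  from has_sum_cmult_left[OF this, of "inverse (mu G x)"]
  have "((\<lambda>y. trans_prob G x y) has_sum 1) {y. adj G x y}"
    using mu_pos[of x]
    by (subst has_sum_cong[where g = "\<lambda>y. weight G x y * inverse (mu G x)"])
       (auto simp: trans_prob_def divide_inverse)
  then have hs: "((\<lambda>y. trans_prob G x y) has_sum 1) UNIV"
    by (rule has_sum_cong_neutral[THEN iffD1, rotated -1]) (auto simp: trans_prob_def)
  have nn: "trans_prob G x y \<ge> 0" for y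
    using mu_pos[of x] weight_pos[of x y] by (auto simp: trans_prob_def)
  have "Infinite_Sum.abs_summable_on (trans_prob G x) UNIV"
    using hs nn by (auto simp: summable_on_def)
  then have sm: "Infinite_Set_Sum.abs_summable_on (trans_prob G x) UNIV"
    by (simp only: abs_summable_equivalent)
  then have "(\<integral>\<^sup>+y. ennreal (trans_prob G x y) \<partial>count_space UNIV) =
      ennreal (infsetsum (trans_prob G x) UNIV)"
    using nn by (intro nn_integral_conv_infsetsum) auto
  also have "infsetsum (trans_prob G x) UNIV = 1"
    using infsetsum_infsum[OF sm] infsumI[OF hs] by simp
  finally show "emeasure (step G x) (space (step G x)) = 1"
    by (simp add: step_def emeasure_density)
qed

sublocale rw: Ionescu_Tulcea "rw_kernel G x" "\<lambda>_. count_space UNIV" for x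
proof (rule Ionescu_Tulcea.intro)
  have step: "step G \<in> measurable (count_space UNIV) (subprob_algebra (count_space UNIV))"
    using prob_space_step
    by (auto simp: space_subprob_algebra prob_space_imp_subprob_space) (simp add: step_def)
  show "rw_kernel G x i \<in>
      measurable (PiM {0..<i} (\<lambda>_. count_space UNIV)) (subprob_algebra (count_space UNIV))" for i
  proof (cases i)
    case 0
    then show ?thesis
      by (auto simp: rw_kernel_def[abs_def] space_subprob_algebra
               intro!: measurable_const prob_space_imp_subprob_space prob_space_return)
  next
    case (Suc k)
    have "(\<lambda>\<omega>. step G (\<omega> k)) \<in>
        measurable (PiM {0..<i} (\<lambda>_. count_space UNIV)) (subprob_algebra (count_space UNIV))"
      using Suc by (intro measurable_compose[OF _ step] measurable_component_singleton) auto
    then show ?thesis using Suc by (simp add: rw_kernel_def[abs_def])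
  qed
  show "prob_space (rw_kernel G x i \<omega>)" for i \<omega>
    by (cases i) (auto simp: rw_kernel_def prob_space_step intro!: prob_space_return)
qed

lemma rw_eq: "rw G x = rw.PF.lim x"
  by (simp add: rw_def)

end

end

theory Submission
  imports Defs
begin

text \<open>
  The walk from \<open>y\<close> to \<open>x\<close> splits at the hitting time of \<open>x\<close>, so by symmetry of the heat kernel
  \<open>heat_kernel_sum G n x y\<close> is at least the probability that \<open>y\<close> hits \<open>x\<close> within time \<open>n\<close>, times the
  minimum of \<open>heat_kernel_sum G k x x\<close> over \<open>k \<le> n\<close>.

  On the diagonal, the bound on the mean exit times makes the walk stay with probability bounded
  below in a ball whose mean exit time is comparable to the time elapsed; reversibility and the
  Cauchy-Schwarz inequality turn this into a lower bound by the inverse volume of that ball.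

  The hitting probability is bounded below by chaining along a geodesic. If \<open>l\<close> is admissible and
  less than the distance \<open>d\<close>, the geodesic is cut into at most \<open>l\<close> pieces of length at most
  \<open>\<lceil>d / l\<rceil>\<close>. Very strong recurrence lets the walk traverse a piece before leaving a ball of twice its
  length, and by Markov's inequality it leaves that ball within time \<open>n / l\<close>, up to a small
  probability. If \<open>l9\<close> is at least \<open>d\<close>, following the geodesic edge by edge suffices.
\<close>

section \<open>Exit times and their tail sums\<close>

lemma less_exit_time_iff: "enat n < exit_time A \<omega> \<longleftrightarrow> (\<forall>i\<le>n. \<omega> i \<in> A)"
proof -
  have "enat n < exit_time A \<omega> \<longleftrightarrow> enat (Suc n) \<le> exit_time A \<omega>"
    by (cases "exit_time A \<omega>") auto
  also have "\<dots> \<longleftrightarrow> (\<forall>i\<le>n. \<omega> i \<in> A)"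
    unfolding exit_time_def le_INF_iff by (auto simp: not_less_eq_eq)
  finally show ?thesis .
qed

text \<open>Tail-sum formula: it turns a mean exit time into the sum over n of the probabilities of
  not having left by time n.\<close>

lemma ennreal_of_enat_eq_suminf:
  "ennreal_of_enat e = (\<Sum>n. if enat n < e then 1 else 0)"
proof (cases e)
  case (enat k)
  have "(\<Sum>n. if enat n < e then 1 else 0 :: ennreal) = (\<Sum>n<k. if enat n < e then 1 else 0)"
    using enat by (intro suminf_finite) auto
  then show ?thesis using enat by simp
next
  case infinity
  have "of_nat k \<le> (\<Sum>n. 1 :: ennreal)" for k
    using sum_le_suminf[of "\<lambda>_. 1 :: ennreal" "{..<k}"] by simp
  then have "(\<Sum>n. 1 :: ennreal) = top"
    by (meson ennreal_Ex_less_of_nat leD less_le top.not_eq_extremum)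
  then show ?thesis using infinity by simp
qed

context weighted_graph
begin

section \<open>The graph distance\<close>

lemma walk_betw_singleton: "walk_betw G x [x] x"
  by (simp add: walk_betw_def)

lemma walk_betw_append:
  assumes "walk_betw G x xs y" "walk_betw G y ys z"
  shows "walk_betw G x (xs @ tl ys) z"
proof (cases ys)
  case Nil
  with assms show ?thesis by (simp add: walk_betw_def)
next
  case (Cons a as)
  with assms show ?thesis
    by (cases as) (auto simp: walk_betw_def successively_append_iff)
qed

lemma walk_betw_rev: "walk_betw G x xs y \<Longrightarrow> walk_betw G y (rev xs) x"
  unfolding walk_betw_def
  by (auto simp: hd_rev last_rev successively_rev intro: successively_mono adj_sym)

lemma gdist_walk: "\<exists>xs. walk_betw G x xs y \<and> length xs = Suc (gdist G x y)"
proof -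
  obtain xs where xs: "walk_betw G x xs y" using connected by blast
  then have "length xs = Suc (length xs - 1)" by (cases xs) (auto simp: walk_betw_def)
  with xs show ?thesis unfolding gdist_def by (intro LeastI) blast
qed

lemma gdist_le: "walk_betw G x xs y \<Longrightarrow> length xs \<le> Suc n \<Longrightarrow> gdist G x y \<le> n"
proof -
  assume w: "walk_betw G x xs y" and l: "length xs \<le> Suc n"
  then have "length xs = Suc (length xs - 1)" by (cases xs) (auto simp: walk_betw_def)
  with w have "gdist G x y \<le> length xs - 1" unfolding gdist_def by (intro Least_le) blast
  with l show ?thesis by simp
qed

lemma gdist_self [simp]: "gdist G x x = 0"
  using gdist_le[OF walk_betw_singleton, of x 0] by simp

lemma gdist_triangle: "gdist G x z \<le> gdist G x y + gdist G y z"
proof -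
  obtain xs ys where "walk_betw G x xs y" "length xs = Suc (gdist G x y)"
    "walk_betw G y ys z" "length ys = Suc (gdist G y z)" using gdist_walk by metis
  then show ?thesis by (intro gdist_le[OF walk_betw_append]) auto
qed

lemma gdist_sym: "gdist G x y = gdist G y x"
proof -
  have "gdist G x y \<le> gdist G y x" for x y
  proof -
    obtain xs where "walk_betw G y xs x" "length xs = Suc (gdist G y x)" using gdist_walk by metis
    then show ?thesis by (intro gdist_le[OF walk_betw_rev]) auto
  qed
  from this[of x y] this[of y x] show ?thesis by simp
qed

lemma gdist_eq_0_iff [simp]: "gdist G x y = 0 \<longleftrightarrow> x = y"
proof
  assume "gdist G x y = 0"
  then obtain xs where "walk_betw G x xs y" "length xs = 1" using gdist_walk[of x y] by auto
  then show "x = y" by (auto simp: walk_betw_def length_Suc_conv)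
qed auto

lemma gdist_adj: "adj G x y \<Longrightarrow> gdist G x y \<le> 1"
  by (rule gdist_le[of _ "[x, y]"]) (auto simp: walk_betw_def)

lemma gdist_Suc_neighbour:
  assumes "gdist G x y = Suc n"
  obtains z where "adj G x z" "gdist G z y = n"
proof -
  obtain xs where xs: "walk_betw G x xs y" "length xs = Suc (Suc n)"
    using gdist_walk[of x y] assms by auto
  then obtain z as where eq: "xs = x # z # as" by (auto simp: walk_betw_def length_Suc_conv)
  from xs eq have "adj G x z" "walk_betw G z (z # as) y" by (auto simp: walk_betw_def)
  moreover from this xs eq have "gdist G z y \<le> n" by (intro gdist_le[of z "z # as"]) auto
  moreover have "Suc n \<le> gdist G x z + gdist G z y" using gdist_triangle[of x y z] assms by simp
  ultimately show ?thesis using gdist_adj[of x z] by (intro that[of z]) auto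
qed

lemma walk_betw_nth_gdist:
  assumes w: "walk_betw G x xs y" and ij: "i \<le> j" "j < length xs"
  shows "gdist G (xs ! i) (xs ! j) \<le> j - i"
proof -
  let ?ys = "take (Suc (j - i)) (drop i xs)"
  have "successively (adj G) ?ys"
    using w by (metis append_take_drop_id successively_append_iff walk_betw_def)
  moreover have "length ?ys = Suc (j - i)" using ij by simp
  then have "last ?ys = xs ! j" using ij
    by (subst last_conv_nth) auto
  ultimately have "walk_betw G (xs ! i) ?ys (xs ! j)"
    using ij by (auto simp: walk_betw_def hd_drop_conv_nth)
  then show ?thesis by (rule gdist_le) simp
qed

text \<open>If the segment from i to j could be shortened, the triangle inequality would make the
  whole distance from x to y smaller than it is.\<close>

lemma geodesic_nth_gdist:
  assumes w: "walk_betw G x xs y" and len: "length xs = Suc (gdist G x y)"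
    and ij: "i \<le> j" "j \<le> gdist G x y"
  shows "gdist G (xs ! i) (xs ! j) = j - i"
proof -
  have ends: "xs ! 0 = x" "xs ! gdist G x y = y"
    using w len last_conv_nth[of xs] by (auto simp: walk_betw_def hd_conv_nth simp del: gdist_eq_0_iff)
  have "gdist G x (xs ! i) \<le> i" "gdist G (xs ! i) (xs ! j) \<le> j - i"
    "gdist G (xs ! j) y \<le> gdist G x y - j"
    using walk_betw_nth_gdist[OF w, of 0 i] walk_betw_nth_gdist[OF w, of i j]
      walk_betw_nth_gdist[OF w, of j "gdist G x y"] ij len ends by auto
  moreover have "gdist G x y \<le> gdist G x (xs ! i) + (gdist G (xs ! i) (xs ! j) + gdist G (xs ! j) y)"
    using gdist_triangle[of x y "xs ! i"] gdist_triangle[of "xs ! i" y "xs ! j"] by linarith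
  ultimately show ?thesis using ij by linarith
qed

section \<open>From path space to transition operators\<close>

text \<open>The marginal of the limit measure on the first n coordinates is the composition of the
  first n kernels, so functions of finitely many positions can be integrated step by step.\<close>

lemma nn_integral_rw_restrict:
  assumes "f \<in> borel_measurable (PiM {0..<n} (\<lambda>_. count_space UNIV))"
  shows "(\<integral>\<^sup>+\<omega>. f (restrict \<omega> {0..<n}) \<partial>rw G x) = (\<integral>\<^sup>+\<omega>. f \<omega> \<partial>rw.C x 0 n (\<lambda>_. undefined))"
proof -
  have 1: "rw.up_to {0..<n} = n" unfolding rw.up_to_def
    by (rule Least_equality) (auto simp: not_less_eq_eq[symmetric] intro: ccontr)
  have "(\<integral>\<^sup>+\<omega>. f (restrict \<omega> {0..<n}) \<partial>rw G x)
     = (\<integral>\<^sup>+\<omega>. f \<omega> \<partial>distr (rw.PF.lim x) (PiM {0..<n} (\<lambda>_. count_space UNIV)) (\<lambda>\<omega>. restrict \<omega> {0..<n}))"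
    using assms by (subst nn_integral_distr) (auto simp: rw_eq measurable_cong_sets[OF rw.PF.sets_lim refl] intro!: measurable_restrict_subset)
  also have "\<dots> = (\<integral>\<^sup>+\<omega>. f \<omega> \<partial>rw.CI x {0..<n})" by (subst rw.distr_lim) auto
  also have "\<dots> = (\<integral>\<^sup>+\<omega>. f (restrict \<omega> {0..<n}) \<partial>rw.C x 0 n (\<lambda>_. undefined))"
    unfolding rw.CI_def 1 using assms
    apply (subst nn_integral_distr)
      apply (auto simp: measurable_cong_sets[OF rw.sets_C refl] intro!: measurable_restrict_subset)
    done
  also have "\<dots> = (\<integral>\<^sup>+\<omega>. f \<omega> \<partial>rw.C x 0 n (\<lambda>_. undefined))"
    by (intro nn_integral_cong) (auto simp: rw.space_C space_PiM simp del: restrict_apply)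
  finally show ?thesis .
qed

text \<open>The Markov operator of the walk. Values in \<open>ennreal\<close> avoid all
  integrability questions.\<close>

definition trans_op :: "('a \<Rightarrow> ennreal) \<Rightarrow> 'a \<Rightarrow> ennreal" where
  "trans_op f x = (\<integral>\<^sup>+y. f y \<partial>step G x)"

text \<open>The Markov operator of the walk killed on leaving A. The indicator sits at the starting
  point, so the n-th power constrains times 0 to n - 1 and leaves time n to the argument f.\<close>

definition killed :: "'a set \<Rightarrow> ('a \<Rightarrow> ennreal) \<Rightarrow> 'a \<Rightarrow> ennreal" where
  "killed A f x = indicator A x * trans_op f x"

lemma nn_integral_rw_0: "(\<integral>\<^sup>+\<omega>. g (\<omega> 0) \<partial>rw G x) = g x"
proof -
  let ?M = "\<lambda>_::nat. count_space (UNIV :: 'a set)"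
  have m: "(\<lambda>\<omega>. g (\<omega> 0)) \<in> borel_measurable (PiM {0..<Suc 0} ?M)"
    by (rule measurable_compose[OF measurable_component_singleton]) auto
  have u: "(\<lambda>_. undefined) \<in> space (PiM {0..<0} ?M)" by (simp add: space_PiM)
  have "(\<integral>\<^sup>+\<omega>. g (\<omega> 0) \<partial>rw G x) = (\<integral>\<^sup>+\<omega>. g (restrict \<omega> {0..<Suc 0} 0) \<partial>rw G x)" by simp
  also have "\<dots> = (\<integral>\<^sup>+\<omega>. g (\<omega> 0) \<partial>rw.C x 0 (Suc 0) (\<lambda>_. undefined))"
    by (rule nn_integral_rw_restrict[OF m])
  also have "\<dots> = (\<integral>\<^sup>+\<omega>. g (\<omega> 0) \<partial>rw.eP x 0 (\<lambda>_. undefined))"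
    using rw.measurable_eP[of x 0] u by (simp add: bind_return[of _ _ "PiM {0..<Suc 0} ?M"])
  also have "\<dots> = g x"
    using rw.nn_integral_eP[OF u m] by (simp add: rw_kernel_def nn_integral_return)
  finally show ?thesis .
qed

text \<open>The Markov property at the last step: given the past up to time n, the next position has
  law \<open>step G (\<omega> n)\<close>.\<close>

lemma nn_integral_rw_Suc:
  assumes f: "f \<in> borel_measurable (PiM {0..<Suc n} (\<lambda>_. count_space UNIV))"
  shows "(\<integral>\<^sup>+\<omega>. f (restrict \<omega> {0..<Suc n}) * g (\<omega> (Suc n)) \<partial>rw G x)
    = (\<integral>\<^sup>+\<omega>. f (restrict \<omega> {0..<Suc n}) * trans_op g (\<omega> n) \<partial>rw G x)"
proof -
  let ?M = "\<lambda>_::nat. count_space (UNIV :: 'a set)" and ?u = "\<lambda>_::nat. undefined :: 'a"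
  have u: "?u \<in> space (PiM {0..<0} ?M)" by (simp add: space_PiM)
  have g: "(\<lambda>\<omega>. h (\<omega> i)) \<in> borel_measurable (PiM {0..<m} ?M)" if "i < m" for h :: "'a \<Rightarrow> ennreal" and i m
    using that by (intro measurable_compose[OF measurable_component_singleton]) auto
  have m1: "(\<lambda>\<omega>. f (restrict \<omega> {0..<Suc n}) * g (\<omega> (Suc n))) \<in> borel_measurable (PiM {0..<Suc (Suc n)} ?M)"
    by (intro borel_measurable_times_ennreal g measurable_compose[OF measurable_restrict_subset f]) auto
  have m2: "(\<lambda>\<omega>. f \<omega> * trans_op g (\<omega> n)) \<in> borel_measurable (PiM {0..<Suc n} ?M)"
    by (intro borel_measurable_times_ennreal g f) auto
  have r: "restrict (restrict \<omega> {0..<Suc (Suc n)}) {0..<Suc n} = restrict \<omega> {0..<Suc n}" for \<omega> :: "nat \<Rightarrow> 'a"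
    by (auto simp: restrict_def)
  have "(\<integral>\<^sup>+\<omega>. f (restrict \<omega> {0..<Suc n}) * g (\<omega> (Suc n)) \<partial>rw G x)
    = (\<integral>\<^sup>+\<omega>. f (restrict \<omega> {0..<Suc n}) * g (\<omega> (Suc n)) \<partial>rw.C x 0 (Suc (Suc n)) ?u)"
    using nn_integral_rw_restrict[OF m1, of x] by (simp add: r)
  also have "\<dots> = (\<integral>\<^sup>+\<omega>. \<integral>\<^sup>+\<omega>'. f (restrict \<omega>' {0..<Suc n}) * g (\<omega>' (Suc n)) \<partial>rw.eP x (Suc n) \<omega> \<partial>rw.C x 0 (Suc n) ?u)"
    unfolding rw.C.simps(2)[of x 0 "Suc n"] using rw.measurable_eP[of x "Suc n"] m1 
    by (subst nn_integral_bind[where B="PiM {0..<Suc (Suc n)} ?M"])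
       (auto simp: measurable_cong_sets[OF rw.sets_C[OF u] refl] simp del: rw.C.simps)
  also have "\<dots> = (\<integral>\<^sup>+\<omega>. f \<omega> * trans_op g (\<omega> n) \<partial>rw.C x 0 (Suc n) ?u)"
  proof (rule nn_integral_cong)
    fix \<omega> assume "\<omega> \<in> space (rw.C x 0 (Suc n) ?u)"
    then have w: "\<omega> \<in> space (PiM {0..<Suc n} ?M)" using rw.space_C[OF u, of x "Suc n"] by simp
    \<comment> \<open>The last kernel only appends a coordinate, so the function of the past is
      constant in the inner integral.\<close>
    have e: "restrict (fun_upd \<omega> (Suc n) y) {0..<Suc n} = \<omega>" for y
      using w by (auto simp: space_PiM fun_eq_iff PiE_def extensional_def)
    show "(\<integral>\<^sup>+\<omega>'. f (restrict \<omega>' {0..<Suc n}) * g (\<omega>' (Suc n)) \<partial>rw.eP x (Suc n) \<omega>) = f \<omega> * trans_op g (\<omega> n)"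
      by (subst rw.nn_integral_eP[OF w m1])
         (simp add: e rw_kernel_def trans_op_def nn_integral_cmult step_def del: restrict_apply)
  qed
  also have "\<dots> = (\<integral>\<^sup>+\<omega>. f (restrict \<omega> {0..<Suc n}) * trans_op g (restrict \<omega> {0..<Suc n} n) \<partial>rw G x)"
    by (rule nn_integral_rw_restrict[OF m2, symmetric])
  finally show ?thesis by simp
qed

text \<open>The bridge from trajectories to operators. The induction generalises g because peeling
  off the last step replaces g by \<open>killed A g\<close>.\<close>

lemma nn_integral_rw_killed:
  "(\<integral>\<^sup>+\<omega>. (\<Prod>i<n. indicator A (\<omega> i)) * g (\<omega> n) \<partial>rw G x) = (killed A ^^ n) g x"
proof (induction n arbitrary: g)
  case 0
  then show ?case by (simp add: nn_integral_rw_0)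
next
  case (Suc n)
  have m: "(\<lambda>\<omega>. \<Prod>i<Suc n. indicator A (\<omega> i) :: ennreal) \<in> borel_measurable (PiM {0..<Suc n} (\<lambda>_. count_space UNIV))"
    by (intro borel_measurable_prod_ennreal measurable_compose[OF measurable_component_singleton]) auto
  have "(\<integral>\<^sup>+\<omega>. (\<Prod>i<Suc n. indicator A (\<omega> i)) * g (\<omega> (Suc n)) \<partial>rw G x)
     = (\<integral>\<^sup>+\<omega>. (\<Prod>i<Suc n. indicator A (\<omega> i)) * trans_op g (\<omega> n) \<partial>rw G x)"
    using nn_integral_rw_Suc[OF m, where g = g and x = x] by simp
  also have "\<dots> = (\<integral>\<^sup>+\<omega>. (\<Prod>i<n. indicator A (\<omega> i)) * killed A g (\<omega> n) \<partial>rw G x)"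
    by (simp add: killed_def mult.assoc)
  also have "\<dots> = (killed A ^^ n) (killed A g) x" by (rule Suc.IH)
  finally show ?case by (simp add: funpow_Suc_right del: funpow.simps)
qed

section \<open>Algebra of the transition operators\<close>

lemma trans_op_eq: "trans_op f x = (\<integral>\<^sup>+y. ennreal (trans_prob G x y) * f y \<partial>count_space UNIV)"
  unfolding trans_op_def step_def by (subst nn_integral_density) auto

lemma trans_op_mono: "(\<And>y. f y \<le> g y) \<Longrightarrow> trans_op f x \<le> trans_op g x"
  unfolding trans_op_def by (rule nn_integral_mono)

lemma measurable_step [measurable, simp]: "f \<in> borel_measurable (step G x)"
  by (simp add: step_def)

lemma trans_op_add: "trans_op (\<lambda>y. f y + g y) x = trans_op f x + trans_op g x"
  unfolding trans_op_def by (rule nn_integral_add) auto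

lemma trans_op_cmult: "trans_op (\<lambda>y. c * f y) x = c * trans_op f x"
  unfolding trans_op_def by (rule nn_integral_cmult) auto

lemma trans_op_const: "trans_op (\<lambda>y. c) x = c"
  unfolding trans_op_def using prob_space.emeasure_space_1[OF prob_space_step] by simp

lemma trans_op_suminf: "trans_op (\<lambda>y. \<Sum>i. f i y) x = (\<Sum>i. trans_op (f i) x)"
  unfolding trans_op_def by (rule nn_integral_suminf) auto

lemma trans_op_sum: "trans_op (\<lambda>y. \<Sum>i\<in>I. f i y) x = (\<Sum>i\<in>I. trans_op (f i) x)"
  unfolding trans_op_def by (rule nn_integral_sum) auto

lemma trans_op_ge: "ennreal (trans_prob G x y) * f y \<le> trans_op f x"
proof -
  have "ennreal (trans_prob G x y) * f y
      = (\<integral>\<^sup>+z. ennreal (trans_prob G x z) * f z * indicator {y} z \<partial>count_space UNIV)"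
    by simp
  also have "\<dots> \<le> trans_op f x"
    unfolding trans_op_eq by (intro nn_integral_mono) (auto split: split_indicator)
  finally show ?thesis .
qed

lemma killed_UNIV: "killed UNIV = trans_op"
  by (simp add: killed_def fun_eq_iff)

lemma killed_mono: "A \<subseteq> B \<Longrightarrow> (\<And>y. f y \<le> g y) \<Longrightarrow> killed A f x \<le> killed B g x"
  unfolding killed_def by (intro mult_mono trans_op_mono) (auto split: split_indicator)

lemma killed_pow_mono:
  "A \<subseteq> B \<Longrightarrow> (\<And>y. f y \<le> g y) \<Longrightarrow> (killed A ^^ n) f x \<le> (killed B ^^ n) g x"
  by (induction n arbitrary: x) (auto intro: killed_mono)

lemma killed_pow_cmult: "(killed A ^^ n) (\<lambda>y. c * f y) = (\<lambda>x. c * (killed A ^^ n) f x)"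
  by (induction n) (auto simp: killed_def trans_op_cmult ac_simps)

lemma killed_pow_suminf: "(killed A ^^ n) (\<lambda>y. \<Sum>i. f i y) = (\<lambda>x. \<Sum>i. (killed A ^^ n) (f i) x)"
  by (induction n) (auto simp: killed_def trans_op_suminf)

lemma trans_op_pow_mono: "(\<And>y. f y \<le> g y) \<Longrightarrow> (trans_op ^^ n) f x \<le> (trans_op ^^ n) g x"
  using killed_pow_mono[of UNIV UNIV] by (simp add: killed_UNIV)

lemma trans_op_pow_sum: "(trans_op ^^ n) (\<lambda>y. \<Sum>i\<in>I. f i y) = (\<lambda>x. \<Sum>i\<in>I. (trans_op ^^ n) (f i) x)"
  by (induction n) (auto simp: trans_op_sum)

lemma trans_op_pow_cmult: "(trans_op ^^ n) (\<lambda>y. c * f y) = (\<lambda>x. c * (trans_op ^^ n) f x)"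
  by (induction n) (auto simp: trans_op_cmult)

text \<open>\<open>survival A n x\<close> is the probability that the walk from \<open>x\<close> exits \<open>A\<close> after time \<open>n\<close>.\<close>

definition survival :: "'a set \<Rightarrow> nat \<Rightarrow> 'a \<Rightarrow> ennreal" where
  "survival A n = (killed A ^^ n) (indicator A)"

text \<open>The mean exit time in tail-sum form; \<open>nn_integral_exit_time\<close> identifies it
  with the expectation over trajectories.\<close>

definition expected_exit :: "'a set \<Rightarrow> 'a \<Rightarrow> ennreal" where
  "expected_exit A x = (\<Sum>n. survival A n x)"

lemma survival_0 [simp]: "survival A 0 = indicator A"
  by (simp add: survival_def)

lemma survival_Suc: "survival A (Suc n) x = indicator A x * trans_op (survival A n) x"
  by (simp add: survival_def killed_def)

lemma survival_add: "survival A (n + m) = (killed A ^^ n) (survival A m)"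
  by (simp add: survival_def funpow_add)

lemma survival_le_1: "survival A n x \<le> 1"
proof (induction n arbitrary: x)
  case (Suc n)
  have "trans_op (survival A n) x \<le> trans_op (\<lambda>_. 1) x" by (intro trans_op_mono Suc)
  then show ?case by (auto simp: survival_Suc trans_op_const split: split_indicator)
qed (auto split: split_indicator)

lemma survival_outside: "x \<notin> A \<Longrightarrow> survival A n x = 0"
  by (cases n) (auto simp: survival_Suc)

lemma survival_antimono: "n \<le> m \<Longrightarrow> survival A m x \<le> survival A n x"
proof (induction rule: dec_induct)
  case (step k)
  have "survival A (Suc k) x \<le> survival A k x" for x
  proof (induction k arbitrary: x)
    case 0
    show ?case using survival_le_1[of A "Suc 0" x] by (cases "x \<in> A") (auto simp: survival_outside)
  next
    case (Suc k)
    show ?case using trans_op_mono[OF Suc, where x = x] 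
      by (subst (1 2) survival_Suc) (intro mult_left_mono, auto)
  qed
  with step show ?case by (meson order_trans)
qed auto

lemma survival_mono: "A \<subseteq> B \<Longrightarrow> survival A n x \<le> survival B n x"
  unfolding survival_def by (intro killed_pow_mono) (auto split: split_indicator)

lemma expected_exit_outside: "x \<notin> A \<Longrightarrow> expected_exit A x = 0"
  by (simp add: expected_exit_def survival_outside)

section \<open>Survival, mean exit times and positions in path space\<close>

lemma measurable_rw_component: "(\<lambda>\<omega>. \<omega> i) \<in> measurable (rw G x) (count_space UNIV)"
  by (simp add: rw_eq measurable_cong_sets[OF rw.PF.sets_lim refl])

lemma sets_rw_stay: "{\<omega> \<in> space (rw G x). \<forall>i\<le>n. \<omega> i \<in> A} \<in> sets (rw G x)"
proof -
  have "{\<omega> \<in> space (rw G x). \<forall>i\<le>n. \<omega> i \<in> A} = (\<Inter>i\<in>{..n}. (\<lambda>\<omega>. \<omega> i) -` A \<inter> space (rw G x))"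
    by auto
  also have "\<dots> \<in> sets (rw G x)"
    by (intro sets.finite_INT measurable_sets[OF measurable_rw_component]) auto
  finally show ?thesis .
qed

lemma emeasure_rw_stay:
  "emeasure (rw G x) {\<omega> \<in> space (rw G x). \<forall>i\<le>n. \<omega> i \<in> A} = survival A n x"
proof -
  have "(\<Prod>i<n. indicator A (\<omega> i)) * indicator A (\<omega> n)
      = (indicator {\<omega> \<in> space (rw G x). \<forall>i\<le>n. \<omega> i \<in> A} \<omega> :: ennreal)"
    if "\<omega> \<in> space (rw G x)" for \<omega>
  proof -
    have "(\<Prod>i<n. indicator A (\<omega> i)) * indicator A (\<omega> n) = (\<Prod>i\<le>n. indicator A (\<omega> i) :: ennreal)"
      by (simp flip: lessThan_Suc_atMost)
    also have "\<dots> = indicator {\<omega> \<in> space (rw G x). \<forall>i\<le>n. \<omega> i \<in> A} \<omega>"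
    proof (cases "\<forall>i\<le>n. \<omega> i \<in> A")
      case True
      then show ?thesis using that by simp
    next
      case False
      then obtain i where "i \<le> n" "\<omega> i \<notin> A" by blast
      then have "(\<Prod>i\<le>n. indicator A (\<omega> i) :: ennreal) = 0" by (intro prod_zero bexI[of _ i]) auto
      then show ?thesis using False by simp
    qed
    finally show ?thesis .
  qed
  then have "(\<integral>\<^sup>+\<omega>. (\<Prod>i<n. indicator A (\<omega> i)) * indicator A (\<omega> n) \<partial>rw G x)
     = (\<integral>\<^sup>+\<omega>. indicator {\<omega> \<in> space (rw G x). \<forall>i\<le>n. \<omega> i \<in> A} \<omega> \<partial>rw G x)"
    by (intro nn_integral_cong)
  then show ?thesis by (simp add: nn_integral_rw_killed survival_def sets_rw_stay)
qed

lemma nn_integral_exit_time: "(\<integral>\<^sup>+\<omega>. ennreal_of_enat (exit_time A \<omega>) \<partial>rw G x) = expected_exit A x"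
proof -
  have "(\<integral>\<^sup>+\<omega>. ennreal_of_enat (exit_time A \<omega>) \<partial>rw G x)
     = (\<integral>\<^sup>+\<omega>. (\<Sum>n. indicator {\<omega> \<in> space (rw G x). \<forall>i\<le>n. \<omega> i \<in> A} \<omega>) \<partial>rw G x)"
    by (intro nn_integral_cong)
       (auto simp: ennreal_of_enat_eq_suminf less_exit_time_iff intro!: suminf_cong)
  also have "\<dots> = (\<Sum>n. \<integral>\<^sup>+\<omega>. indicator {\<omega> \<in> space (rw G x). \<forall>i\<le>n. \<omega> i \<in> A} \<omega> \<partial>rw G x)"
    by (intro nn_integral_suminf borel_measurable_indicator sets_rw_stay)
  also have "\<dots> = expected_exit A x"
    unfolding expected_exit_def by (simp add: emeasure_rw_stay sets_rw_stay)
  finally show ?thesis .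
qed

lemma mean_exit_from_eq: "mean_exit_from G y x R = expected_exit (gball G x R) y"
  by (simp add: mean_exit_from_def nn_integral_exit_time)

lemma prob_space_rw: "prob_space (rw G x)"
proof
  show "emeasure (rw G x) (space (rw G x)) = 1" using emeasure_rw_stay[of x 0 UNIV] by simp
qed

lemma emeasure_rw_eq: "emeasure (rw G x) {\<omega> \<in> space (rw G x). \<omega> n = y} = (trans_op ^^ n) (indicator {y}) x"
proof -
  have "{\<omega> \<in> space (rw G x). \<omega> n = y} = (\<lambda>\<omega>. \<omega> n) -` {y} \<inter> space (rw G x)" by auto
  then have s: "{\<omega> \<in> space (rw G x). \<omega> n = y} \<in> sets (rw G x)"
    using measurable_sets[OF measurable_rw_component] by simp
  have "(trans_op ^^ n) (indicator {y}) x = (\<integral>\<^sup>+\<omega>. indicator {y} (\<omega> n) \<partial>rw G x)"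
    using nn_integral_rw_killed[where A = UNIV and n = n and g = "indicator {y}" and x = x] by (simp add: killed_UNIV)
  also have "\<dots> = (\<integral>\<^sup>+\<omega>. indicator {\<omega> \<in> space (rw G x). \<omega> n = y} \<omega> \<partial>rw G x)"
    by (intro nn_integral_cong) (auto split: split_indicator)
  finally show ?thesis using s by simp
qed

section \<open>Hitting probabilities\<close>

text \<open>\<open>hit_prob z n w\<close> is the probability that the walk from \<open>w\<close> hits \<open>z\<close> by time \<open>n\<close>.\<close>

primrec hit_prob :: "'a \<Rightarrow> nat \<Rightarrow> 'a \<Rightarrow> ennreal" where
  "hit_prob z 0 w = indicator {z} w"
| "hit_prob z (Suc n) w = (if w = z then 1 else trans_op (hit_prob z n) w)"

text \<open>Avoiding z is surviving in the complement of z, and the two complementary probabilities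
  obey the same first-step recursion.\<close>

lemma hit_prob_add_survival: "hit_prob z n w + survival (- {z}) n w = 1"
proof (induction n arbitrary: w)
  case (Suc n)
  have "trans_op (hit_prob z n) w + trans_op (survival (- {z}) n) w = trans_op (\<lambda>_. 1) w"
    by (simp add: Suc flip: trans_op_add)
  then show ?case by (simp add: survival_Suc trans_op_const)
qed (auto split: split_indicator)

lemma hit_prob_le_1: "hit_prob z n w \<le> 1"
  using hit_prob_add_survival[of z n w] by (metis le_iff_add)

lemma hit_prob_self [simp]: "hit_prob z n z = 1"
  by (cases n) auto

lemma hit_prob_Suc_mono: "hit_prob z n w \<le> hit_prob z (Suc n) w"
  by (induction n arbitrary: w) (auto split: split_indicator intro: trans_op_mono)

lemma hit_prob_mono: "n \<le> m \<Longrightarrow> hit_prob z n w \<le> hit_prob z m w"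
  by (rule lift_Suc_mono_le[of "\<lambda>n. hit_prob z n w"]) (rule hit_prob_Suc_mono)

text \<open>Passing through u is one way to reach z. Induction on the first step again stands in for
  the strong Markov property; time left over when u is reached early is absorbed by
  \<open>hit_prob_mono\<close>.\<close>

lemma hit_prob_chain: "hit_prob u a w * hit_prob z b u \<le> hit_prob z (a + b) w"
proof (induction a arbitrary: w)
  case 0
  show ?case by (auto split: split_indicator)
next
  case (Suc a)
  consider "w = z" | "w \<noteq> z" "w = u" | "w \<noteq> z" "w \<noteq> u" by blast
  then show ?case
  proof cases
    case 1
    then show ?thesis using mult_mono[OF hit_prob_le_1 hit_prob_le_1, of u "Suc a" w z b u]
      by (simp add: mult.commute del: hit_prob.simps)
  next
    case 2
    then show ?thesis using hit_prob_mono[of b "Suc a + b" z u] by (auto simp del: hit_prob.simps)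
  next
    case 3
    have "trans_op (hit_prob u a) w * hit_prob z b u = trans_op (\<lambda>v. hit_prob z b u * hit_prob u a v) w"
      unfolding trans_op_cmult by (rule mult.commute)
    also have "\<dots> \<le> trans_op (hit_prob z (a + b)) w"
      using Suc by (intro trans_op_mono) (simp add: mult.commute)
    finally show ?thesis using 3 by simp
  qed
qed

text \<open>
  Induction on the first step replaces the strong Markov property at the hitting time of \<open>x\<close>;
  \<open>q k w\<close> is the expectation, at time \<open>k\<close>, of a function of the walk started at \<open>w\<close>.
\<close>

lemma hit_prob_mult_le:
  assumes q: "\<And>k w. q (Suc k) w = trans_op (q k) w" and m: "\<And>k. k \<le> N \<Longrightarrow> m \<le> q k x"
  shows "k \<le> N \<Longrightarrow> hit_prob x k w * m \<le> q k w"
proof (induction k arbitrary: w)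
  case 0
  then show ?case using m[of 0] by (auto split: split_indicator)
next
  case (Suc k)
  show ?case
  proof (cases "w = x")
    \<comment> \<open>The time remaining when x is reached may be any k \<le> N, which is why m must
      bound all \<open>q k x\<close> at once.\<close>
    case True
    with m[OF Suc.prems] show ?thesis by simp
  next
    case False
    have "trans_op (hit_prob x k) w * m = trans_op (\<lambda>v. m * hit_prob x k v) w"
      unfolding trans_op_cmult by (rule mult.commute)
    also have "\<dots> \<le> trans_op (q k) w"
      using Suc by (intro trans_op_mono) (simp add: mult.commute)
    finally show ?thesis using False by (simp add: q)
  qed
qed

section \<open>Reversibility and the heat kernel\<close>

text \<open>The product of \<open>mu G x\<close> and \<open>trans_prob G x y\<close> is the
  symmetric edge weight, so exchanging the two sums swaps f and g: the operator is self-adjoint with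
  respect to mu.\<close>

lemma trans_op_reversible:
  "(\<integral>\<^sup>+x. f x * ennreal (mu G x) * trans_op g x \<partial>count_space UNIV)
     = (\<integral>\<^sup>+x. g x * ennreal (mu G x) * trans_op f x \<partial>count_space UNIV)"
proof -
  define w where "w x y = (if adj G x y then ennreal (weight G x y) else 0)" for x y
  have w: "ennreal (mu G x) * ennreal (trans_prob G x y) = w x y" for x y
    using mu_pos[of x] weight_pos[of x y]
    by (auto simp: w_def trans_prob_def simp flip: ennreal_mult)
  have w_sym: "w x y = w y x" for x y
    using adj_sym weight_sym by (auto simp: w_def)
  have *: "(\<integral>\<^sup>+x. f x * ennreal (mu G x) * trans_op g x \<partial>count_space UNIV)
      = (\<integral>\<^sup>+x. \<integral>\<^sup>+y. f x * g y * w x y \<partial>count_space UNIV \<partial>count_space UNIV)" for f g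
  proof (rule nn_integral_cong)
    fix x
    have "f x * ennreal (mu G x) * trans_op g x
        = (\<integral>\<^sup>+y. f x * ennreal (mu G x) * (ennreal (trans_prob G x y) * g y) \<partial>count_space UNIV)"
      unfolding trans_op_eq by (rule nn_integral_cmult[symmetric]) auto
    also have "\<dots> = (\<integral>\<^sup>+y. f x * g y * w x y \<partial>count_space UNIV)"
      by (intro nn_integral_cong) (simp add: w[symmetric] ac_simps)
    finally show "f x * ennreal (mu G x) * trans_op g x = (\<integral>\<^sup>+y. f x * g y * w x y \<partial>count_space UNIV)" .
  qed
  have "(\<integral>\<^sup>+x. \<integral>\<^sup>+y. f x * g y * w x y \<partial>count_space UNIV \<partial>count_space UNIV)
      = (\<integral>\<^sup>+y. \<integral>\<^sup>+x. f x * g y * w x y \<partial>count_space UNIV \<partial>count_space UNIV)"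
    using nn_integral_fst_count_space[of "\<lambda>(x, y). f x * g y * w x y"]
      nn_integral_snd_count_space[of "\<lambda>(x, y). f x * g y * w x y"] by simp
  also have "\<dots> = (\<integral>\<^sup>+y. \<integral>\<^sup>+x. g y * f x * w y x \<partial>count_space UNIV \<partial>count_space UNIV)"
    by (simp add: w_sym ac_simps)
  finally show ?thesis by (simp only: *)
qed

lemma trans_op_pow_reversible:
  "(\<integral>\<^sup>+x. f x * ennreal (mu G x) * (trans_op ^^ n) g x \<partial>count_space UNIV)
     = (\<integral>\<^sup>+x. g x * ennreal (mu G x) * (trans_op ^^ n) f x \<partial>count_space UNIV)"
proof (induction n arbitrary: f g)
  case 0
  then show ?case by (simp add: ac_simps)
next
  case (Suc n)
  have "(\<integral>\<^sup>+x. f x * ennreal (mu G x) * (trans_op ^^ Suc n) g x \<partial>count_space UNIV)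
      = (\<integral>\<^sup>+x. f x * ennreal (mu G x) * (trans_op ^^ n) (trans_op g) x \<partial>count_space UNIV)"
    by (simp add: funpow_Suc_right del: funpow.simps)
  also have "\<dots> = (\<integral>\<^sup>+x. (trans_op ^^ n) f x * ennreal (mu G x) * trans_op g x \<partial>count_space UNIV)"
    by (subst Suc) (simp add: ac_simps)
  also have "\<dots> = (\<integral>\<^sup>+x. g x * ennreal (mu G x) * (trans_op ^^ Suc n) f x \<partial>count_space UNIV)"
    by (subst trans_op_reversible) simp
  finally show ?case .
qed

definition prob_at :: "nat \<Rightarrow> 'a \<Rightarrow> 'a \<Rightarrow> real" where
  "prob_at n x y = measure (rw G x) {\<omega> \<in> space (rw G x). \<omega> n = y}"

lemma ennreal_prob_at: "ennreal (prob_at n x y) = (trans_op ^^ n) (indicator {y}) x"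
proof -
  interpret prob_space "rw G x" by (rule prob_space_rw)
  show ?thesis by (simp add: prob_at_def flip: emeasure_eq_measure emeasure_rw_eq)
qed

lemma prob_at_nonneg: "0 \<le> prob_at n x y"
  by (simp add: prob_at_def)

lemma prob_at_reversible: "mu G x * prob_at n x y = mu G y * prob_at n y x"
proof -
  have *: "(\<integral>\<^sup>+z. indicator {x} z * ennreal (mu G z) * f z \<partial>count_space UNIV) = ennreal (mu G x) * f x"
    for x and f :: "'a \<Rightarrow> ennreal"
    using nn_integral_indicator_singleton[of x "count_space UNIV" "\<lambda>z. ennreal (mu G z) * f z"]
    by (simp add: ac_simps)
  have "ennreal (mu G x * prob_at n x y) = ennreal (mu G y * prob_at n y x)"
    using trans_op_pow_reversible[of "indicator {x}" n "indicator {y}"] mu_pos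
    by (simp add: * ennreal_mult prob_at_nonneg ennreal_prob_at less_imp_le)
  then show ?thesis using mu_pos prob_at_nonneg by (subst (asm) ennreal_inj) (auto simp: less_imp_le)
qed

lemma heat_kernel_eq: "heat_kernel G n x y = prob_at n x y / mu G y"
  by (simp add: heat_kernel_def prob_at_def)

lemma heat_kernel_sym: "heat_kernel G n x y = heat_kernel G n y x"
  using prob_at_reversible[of x n y] mu_pos[of x] mu_pos[of y]
  by (simp add: heat_kernel_eq field_simps)

lemma heat_kernel_sum_sym: "heat_kernel_sum G n x y = heat_kernel_sum G n y x"
  by (simp add: heat_kernel_sum_def heat_kernel_sym[of _ x y])

text \<open>Chapman-Kolmogorov with the position at time n restricted to A, hence an
  inequality.\<close>

lemma sum_prob_at_le: "finite A \<Longrightarrow> (\<Sum>z\<in>A. prob_at n x z * prob_at m z y) \<le> prob_at (n + m) x y"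
proof -
  assume A: "finite A"
  have "ennreal (\<Sum>z\<in>A. prob_at n x z * prob_at m z y) = (\<Sum>z\<in>A. ennreal (prob_at m z y) * (trans_op ^^ n) (indicator {z}) x)"
    using prob_at_nonneg by (simp add: ennreal_mult mult.commute flip: ennreal_prob_at sum_ennreal)
  also have "\<dots> = (trans_op ^^ n) (\<lambda>v. \<Sum>z\<in>A. ennreal (prob_at m z y) * indicator {z} v) x"
    by (simp add: trans_op_pow_sum trans_op_pow_cmult)
  also have "\<dots> \<le> (trans_op ^^ n) ((trans_op ^^ m) (indicator {y})) x"
  proof (rule trans_op_pow_mono)
    fix v
    have "(\<Sum>z\<in>A. ennreal (prob_at m z y) * indicator {z} v) = (\<Sum>z\<in>A. if z = v then ennreal (prob_at m v y) else 0)"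
      by (intro sum.cong) (auto split: split_indicator)
    also have "\<dots> \<le> ennreal (prob_at m v y)" using A by simp
    finally show "(\<Sum>z\<in>A. ennreal (prob_at m z y) * indicator {z} v) \<le> (trans_op ^^ m) (indicator {y}) v"
      by (simp add: ennreal_prob_at)
  qed
  also have "\<dots> = ennreal (prob_at (n + m) x y)" by (simp add: ennreal_prob_at funpow_add)
  finally show ?thesis using prob_at_nonneg by (simp add: ennreal_le_iff)
qed

lemma survival_le_sum_prob_at: "finite A \<Longrightarrow> survival A n x \<le> ennreal (\<Sum>z\<in>A. prob_at n x z)"
proof -
  assume A: "finite A"
  have "survival A n x \<le> (trans_op ^^ n) (indicator A) x"
    unfolding survival_def killed_UNIV[symmetric] by (rule killed_pow_mono) auto
  also have "indicator A = (\<lambda>v. \<Sum>z\<in>A. indicator {z} v :: ennreal)"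
  proof
    fix v
    have "(\<Sum>z\<in>A. indicator {z} v :: ennreal) = (\<Sum>z\<in>A. if z = v then 1 else 0)"
      by (intro sum.cong) (auto split: split_indicator)
    then show "indicator A v = (\<Sum>z\<in>A. indicator {z} v :: ennreal)"
      using A by (auto split: split_indicator)
  qed
  also have "(trans_op ^^ n) (\<lambda>v. \<Sum>z\<in>A. indicator {z} v) x = ennreal (\<Sum>z\<in>A. prob_at n x z)"
    by (simp add: trans_op_pow_sum prob_at_nonneg flip: ennreal_prob_at)
  finally show ?thesis .
qed

lemma diagonal_lower_bound:
  assumes A: "finite A" "A \<noteq> {}" and s: "ennreal s \<le> survival A n x" "0 \<le> s"
  shows "s\<^sup>2 / (\<Sum>z\<in>A. mu G z) \<le> heat_kernel G (2 * n) x x"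
proof -
  have pos: "0 < (\<Sum>z\<in>A. mu G z)" using A mu_pos by (intro sum_pos) auto
  have "ennreal s \<le> ennreal (\<Sum>z\<in>A. prob_at n x z)" using s(1) survival_le_sum_prob_at[OF A(1)] by (rule order_trans)
  then have "s \<le> (\<Sum>z\<in>A. prob_at n x z)" using prob_at_nonneg by (simp add: sum_nonneg)
  then have "s\<^sup>2 \<le> (\<Sum>z\<in>A. prob_at n x z)\<^sup>2" using s(2) by (rule power_mono)
  \<comment> \<open>The factors \<open>sqrt (mu G z)\<close> are inserted so that Cauchy-Schwarz
    yields the volume of A times a sum which reversibility turns into a return probability.\<close>
  also have "\<dots> = (\<Sum>z\<in>A. (prob_at n x z / sqrt (mu G z)) * sqrt (mu G z))\<^sup>2"
    using mu_pos by (simp add: less_imp_neq[THEN not_sym])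
  also have "\<dots> \<le> (\<Sum>z\<in>A. (prob_at n x z / sqrt (mu G z))\<^sup>2) * (\<Sum>z\<in>A. (sqrt (mu G z))\<^sup>2)"
    by (rule Cauchy_Schwarz_ineq_sum)
  also have "(\<Sum>z\<in>A. (sqrt (mu G z))\<^sup>2) = (\<Sum>z\<in>A. mu G z)"
    using mu_pos by (intro sum.cong) (auto simp: less_imp_le)
  also have "(\<Sum>z\<in>A. (prob_at n x z / sqrt (mu G z))\<^sup>2) = (\<Sum>z\<in>A. prob_at n x z * prob_at n z x) / mu G x"
  proof -
    have "(prob_at n x z / sqrt (mu G z))\<^sup>2 = prob_at n x z * prob_at n z x / mu G x" for z
      using prob_at_reversible[of x n z] mu_pos[of x] mu_pos[of z]
      by (simp add: power_divide field_simps power2_eq_square)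
    then show ?thesis by (simp add: sum_divide_distrib)
  qed
  also have "(\<Sum>z\<in>A. prob_at n x z * prob_at n z x) / mu G x \<le> heat_kernel G (2 * n) x x"
    using sum_prob_at_le[OF A(1), of n x n x] mu_pos[of x]
    by (simp add: heat_kernel_eq divide_right_mono mult_2 less_imp_le)
  finally show ?thesis using pos by (simp add: field_simps mult_right_mono)
qed

text \<open>The time left after hitting x has uncontrolled parity; summing two consecutive heat
  kernels keeps a positive lower bound possible on bipartite graphs as well.\<close>

lemma heat_kernel_sum_ge_hit_prob:
  assumes m: "\<And>k. k \<le> n \<Longrightarrow> m \<le> heat_kernel_sum G k x x" "0 \<le> m"
    and h: "ennreal h \<le> hit_prob x n y" "0 \<le> h"
  shows "h * m \<le> heat_kernel_sum G n x y"
proof -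
  \<comment> \<open>In this unnormalised form the recursion required by
    \<open>hit_prob_mult_le\<close> is linearity of \<open>trans_op\<close>.\<close>
  define q where "q k w = (trans_op ^^ k) (indicator {x}) w + (trans_op ^^ Suc k) (indicator {x}) w" for k w
  have q_prob_at: "q k w = ennreal (mu G x * heat_kernel_sum G k w x)" for k w
    using mu_pos[of x] prob_at_nonneg unfolding q_def ennreal_prob_at[symmetric]
    by (simp add: heat_kernel_sum_def heat_kernel_eq field_simps flip: ennreal_plus)
  have "ennreal (h * (mu G x * m)) = ennreal h * ennreal (mu G x * m)"
    using h m mu_pos[of x] by (simp add: ennreal_mult)
  also have "\<dots> \<le> hit_prob x n y * ennreal (mu G x * m)" by (intro mult_right_mono h) auto
  also have "\<dots> \<le> q n y"
  proof (rule hit_prob_mult_le[where N = n])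
    show "q (Suc k) w = trans_op (q k) w" for k w
      using trans_op_add[of "(trans_op ^^ k) (indicator {x})" "(trans_op ^^ Suc k) (indicator {x})" w]
      by (simp add: q_def[abs_def])
    show "ennreal (mu G x * m) \<le> q k x" if "k \<le> n" for k
      unfolding q_prob_at using m(1)[OF that] mu_pos[of x] by (intro ennreal_leI mult_left_mono) auto
  qed auto
  also have "\<dots> = ennreal (mu G x * heat_kernel_sum G n y x)" by (rule q_prob_at)
  finally have "h * (mu G x * m) \<le> mu G x * heat_kernel_sum G n y x"
    using mu_pos[of x] prob_at_nonneg
    by (subst (asm) ennreal_le_iff)
       (auto simp: heat_kernel_sum_def heat_kernel_eq intro!: mult_nonneg_nonneg add_nonneg_nonneg less_imp_le)
  then show ?thesis using mu_pos[of x] by (simp add: heat_kernel_sum_sym[of n x y])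
qed

section \<open>Exit times\<close>

lemma expected_exit_mono: "A \<subseteq> B \<Longrightarrow> expected_exit A x \<le> expected_exit B x"
  unfolding expected_exit_def by (intro suminf_le survival_mono) auto

text \<open>The Markov property at time \<open>n\<close> for the walk killed outside \<open>A\<close>.\<close>

lemma expected_exit_le:
  assumes "\<And>y. expected_exit A y \<le> M"
  shows "expected_exit A x \<le> of_nat n + M * survival A n x"
proof -
  have "expected_exit A x = (\<Sum>i. survival A (i + n) x) + (\<Sum>i<n. survival A i x)"
    unfolding expected_exit_def by (rule suminf_offset) auto
  also have "(\<Sum>i<n. survival A i x) \<le> of_nat n"
    using sum_bounded_above[of "{..<n}" "\<lambda>i. survival A i x" 1] survival_le_1 by simp
  also have "(\<Sum>i. survival A (i + n) x) = (killed A ^^ n) (expected_exit A) x"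
    by (simp add: expected_exit_def[abs_def] killed_pow_suminf survival_add add.commute[of _ n])
  \<comment> \<open>The expected residual time vanishes outside A, so the bound M may carry the
    indicator of A, which produces the survival probability.\<close>
  also have "\<dots> \<le> (killed A ^^ n) (\<lambda>y. M * indicator A y) x"
    using assms by (intro killed_pow_mono) (auto simp: expected_exit_outside split: split_indicator)
  also have "\<dots> = M * survival A n x"
    by (simp add: killed_pow_cmult survival_def)
  finally show ?thesis by (simp add: add.commute add_mono)
qed

text \<open>Markov's inequality: surviving up to time n means an exit time of at least n + 1, hence
  the factor \<open>Suc n\<close>.\<close>

lemma survival_markov: "of_nat (Suc n) * survival A n x \<le> expected_exit A x"
proof -
  have "of_nat (Suc n) * survival A n x = (\<Sum>i<Suc n. survival A n x)" by simp
  also have "\<dots> \<le> (\<Sum>i<Suc n. survival A i x)" by (intro sum_mono survival_antimono) auto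
  also have "\<dots> \<le> expected_exit A x" unfolding expected_exit_def by (intro sum_le_suminf) auto
  finally show ?thesis .
qed

lemma trans_op_cong_adj: "(\<And>y. adj G x y \<Longrightarrow> f y = g y) \<Longrightarrow> trans_op f x = trans_op g x"
  unfolding trans_op_eq by (intro nn_integral_cong) (auto simp: trans_prob_def)

text \<open>Each step changes the distance to x by at most 1.\<close>

lemma survival_gball_eq_1: "real (gdist G x y) + real n < R \<Longrightarrow> survival (gball G x R) n y = 1"
proof (induction n arbitrary: y)
  case 0
  then show ?case by (simp add: gball_def)
next
  case (Suc n)
  have "trans_op (survival (gball G x R) n) y = trans_op (\<lambda>_. 1) y"
  proof (rule trans_op_cong_adj)
    fix z assume "adj G y z"
    then have "gdist G x z \<le> gdist G x y + 1"
      using gdist_triangle[of x z y] gdist_adj[of y z] by simp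
    then show "survival (gball G x R) n z = 1" using Suc.prems by (intro Suc.IH) simp
  qed
  then show ?case using Suc.prems by (simp add: survival_Suc trans_op_const gball_def)
qed

lemma mean_exit_eq: "mean_exit G x R = expected_exit (gball G x R) x"
  by (simp add: mean_exit_def mean_exit_from_eq)

text \<open>Leaving the ball takes at least r steps. In particular the minimum defining
  \<open>inv_exit\<close> is over a nonempty set.\<close>

lemma mean_exit_ge: "of_nat r \<le> mean_exit G x (real r)"
proof -
  have "of_nat r = (\<Sum>i<r. survival (gball G x (real r)) i x)"
    by (simp add: survival_gball_eq_1)
  also have "\<dots> \<le> mean_exit G x (real r)"
    unfolding mean_exit_eq expected_exit_def by (intro sum_le_suminf) auto
  finally show ?thesis .
qed

lemma inv_exit: "1 \<le> inv_exit G x n" "of_nat n \<le> mean_exit G x (real (inv_exit G x n))"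
proof -
  have "of_nat n \<le> mean_exit G x (real (max 1 n))"
    using mean_exit_ge[of "max 1 n" x] by (rule order_trans[rotated]) simp
  then have "\<exists>r. r \<ge> 1 \<and> of_nat n \<le> mean_exit G x (real r)"
    by (intro exI[of _ "max 1 n"]) auto
  from LeastI_ex[OF this] show "1 \<le> inv_exit G x n" "of_nat n \<le> mean_exit G x (real (inv_exit G x n))"
    by (auto simp: inv_exit_def)
qed

lemma inv_exit_mono: "k \<le> n \<Longrightarrow> inv_exit G x k \<le> inv_exit G x n"
proof -
  assume "k \<le> n"
  then have "of_nat k \<le> (of_nat n :: ennreal)" by simp
  then have "of_nat k \<le> mean_exit G x (real (inv_exit G x n))" using inv_exit(2) by (rule order_trans)
  then show ?thesis unfolding inv_exit_def[of _ _ k] by (intro Least_le conjI inv_exit)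
qed

lemma survival_less_top: "survival A n x < top"
  using survival_le_1 by (rule le_less_trans) simp

text \<open>If \<open>z\<close> is hit before the exit from \<open>B\<close>, then it is hit by time \<open>k\<close> or the exit is after \<open>k\<close>.\<close>

lemma hit_before_exit:
  assumes "c \<le> measure (rw G w) {\<omega> \<in> space (rw G w). hit_time {z} \<omega> < exit_time B \<omega>}"
  shows "ennreal c \<le> hit_prob z k w + survival B k w"
proof -
  interpret prob_space "rw G w" by (rule prob_space_rw)
  let ?S = "\<lambda>A. {\<omega> \<in> space (rw G w). \<forall>i\<le>k. \<omega> i \<in> A}"
  have "emeasure (rw G w) (space (rw G w) - ?S (- {z})) = 1 - survival (- {z}) k w"
    using emeasure_compl[OF sets_rw_stay[where x = w and n = k and A = "- {z}"]] survival_less_top[of "- {z}" k w]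
    by (simp only: emeasure_rw_stay emeasure_space_1 infinity_ennreal_def less_top simp_thms)
  also have "\<dots> = hit_prob z k w"
    unfolding hit_prob_add_survival[of z k w, symmetric] using survival_less_top[of "- {z}" k w]
    by (intro ennreal_add_diff_cancel_right) (simp only: less_top)
  finally have *: "emeasure (rw G w) (space (rw G w) - ?S (- {z})) = hit_prob z k w" .
  have "ennreal c \<le> emeasure (rw G w) {\<omega> \<in> space (rw G w). hit_time {z} \<omega> < exit_time B \<omega>}"
    using assms by (simp add: emeasure_eq_measure ennreal_leI)
  also have "\<dots> \<le> emeasure (rw G w) ((space (rw G w) - ?S (- {z})) \<union> ?S B)"
  proof (rule emeasure_mono)
    show "{\<omega> \<in> space (rw G w). hit_time {z} \<omega> < exit_time B \<omega>} \<subseteq> (space (rw G w) - ?S (- {z})) \<union> ?S B"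
    proof
      fix \<omega> assume h: "\<omega> \<in> {\<omega> \<in> space (rw G w). hit_time {z} \<omega> < exit_time B \<omega>}"
      have "\<forall>i\<le>k. \<omega> i \<in> B" if "\<forall>i\<le>k. \<omega> i \<in> - {z}"
      proof -
        \<comment> \<open>If z has been avoided up to time k, its hitting time exceeds k, and so
          does the still later exit time.\<close>
        from that have "enat k < hit_time {z} \<omega>" unfolding hit_time_def less_exit_time_iff .
        also have "\<dots> < exit_time B \<omega>" using h by simp
        finally show ?thesis unfolding less_exit_time_iff .
      qed
      then show "\<omega> \<in> (space (rw G w) - ?S (- {z})) \<union> ?S B" using h by blast
    qed
    show "(space (rw G w) - ?S (- {z})) \<union> ?S B \<in> sets (rw G w)"
      by (intro sets.Un sets.Diff sets_rw_stay sets.top)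
  qed
  also have "\<dots> \<le> hit_prob z k w + survival B k w"
    unfolding *[symmetric] emeasure_rw_stay[symmetric, where A = B]
    by (intro emeasure_subadditive sets.Diff sets_rw_stay sets.top)
  finally show ?thesis .
qed

text \<open>Balls are open, so w at distance equal to the radius lies outside, while its successor
  on a geodesic towards z lies inside.\<close>

lemma mem_boundary_gball:
  assumes "gdist G w z = Suc r"
  shows "w \<in> boundary G (gball G z (real (Suc r)))"
proof -
  obtain y where "adj G w y" "gdist G y z = r" using assms by (rule gdist_Suc_neighbour)
  then show ?thesis using assms adj_sym
    by (simp add: boundary_def gball_def gdist_sym[of z]) (intro exI[of _ y], auto)
qed

end

section \<open>Consequences of the lower bound p0 on transition probabilities\<close>

locale p0_graph = weighted_graph +
  fixes p0 :: real
  assumes p0_pos: "0 < p0"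
    and p0_le: "adj G x y \<Longrightarrow> p0 \<le> trans_prob G x y"
begin

text \<open>The transition probabilities out of x have total mass 1 and each is at least p0.\<close>

lemma finite_neighbours: "finite {y. adj G x y}"
proof (rule ccontr)
  assume inf: "infinite {y. adj G x y}"
  have "(\<integral>\<^sup>+y. ennreal p0 * indicator {y. adj G x y} y \<partial>count_space UNIV) \<le> trans_op (\<lambda>_. 1) x"
    unfolding trans_op_eq using p0_le by (intro nn_integral_mono) (auto intro: ennreal_leI split: split_indicator)
  then show False using inf p0_pos
    by (simp add: nn_integral_cmult trans_op_const emeasure_count_space ennreal_mult_top top_unique)
qed

lemma p0_le_1: "p0 \<le> 1"
proof -
  obtain x y where "adj G x y" using ex_neighbour by blast
  then have "ennreal p0 \<le> ennreal (trans_prob G x y) * 1" using p0_le by (simp add: ennreal_leI)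
  also have "\<dots> \<le> trans_op (\<lambda>_. 1) x" by (rule trans_op_ge)
  finally show ?thesis by (simp add: trans_op_const ennreal_le_1)
qed

lemma finite_gball: "finite (gball G x R)"
proof -
  have fin: "finite {y. gdist G x y \<le> n}" for n
  proof (induction n)
    case (Suc n)
    have "{y. gdist G x y \<le> Suc n} \<subseteq> {y. gdist G x y \<le> n} \<union> (\<Union>z\<in>{y. gdist G x y \<le> n}. {y. adj G z y})"
    proof
      fix y assume "y \<in> {y. gdist G x y \<le> Suc n}"
      then consider "gdist G x y \<le> n" | "gdist G y x = Suc n" by (auto simp: gdist_sym[of x] le_Suc_eq)
      then show "y \<in> {y. gdist G x y \<le> n} \<union> (\<Union>z\<in>{y. gdist G x y \<le> n}. {y. adj G z y})"
      proof cases
        case 2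
        then obtain z where "adj G y z" "gdist G z x = n" by (rule gdist_Suc_neighbour)
        then show ?thesis by (auto simp: gdist_sym[of x] intro: adj_sym)
      qed auto
    qed
    then show ?case using Suc finite_neighbours by (elim finite_subset) auto
  qed simp
  have "gball G x R \<subseteq> {y. gdist G x y \<le> nat \<lceil>R\<rceil>}" by (auto simp: gball_def) linarith
  then show ?thesis using fin by (rule finite_subset)
qed

text \<open>Follow a geodesic; each edge costs a factor p0.\<close>

lemma hit_prob_ge_p0_power: "ennreal (p0 ^ gdist G w z) \<le> hit_prob z (gdist G w z) w"
proof (induction "gdist G w z" arbitrary: w)
  case (Suc n)
  obtain v where v: "adj G w v" "gdist G v z = n" using Suc(2)[symmetric] by (rule gdist_Suc_neighbour)
  have "ennreal (p0 ^ Suc n) = ennreal p0 * ennreal (p0 ^ n)" using p0_pos by (simp add: ennreal_mult)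
  also have "\<dots> \<le> ennreal (trans_prob G w v) * hit_prob z n v"
    using Suc(1)[of v] v p0_le[OF v(1)] by (intro mult_mono) (auto intro: ennreal_leI)
  also have "\<dots> \<le> trans_op (hit_prob z n) w" by (rule trans_op_ge)
  also have "\<dots> = hit_prob z (Suc n) w"
  proof -
    have "w \<noteq> z" using Suc(2) by auto
    then show ?thesis by simp
  qed
  finally show ?case by (simp only: Suc(2)[symmetric])
qed auto

text \<open>From every point of A the walk reaches a fixed outside vertex within N steps with
  probability at least \<open>p0 ^ N\<close>, so survival decays geometrically.\<close>

lemma expected_exit_finite:
  assumes A: "finite A"
  shows "expected_exit A x < \<infinity>"
proof -
  obtain z where z: "z \<notin> A" using ex_new_if_finite[OF infinite_vertices A] by blast
  define N where "N = Max (insert 0 ((\<lambda>y. gdist G y z) ` A))"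
  have N: "gdist G y z \<le> N" if "y \<in> A" for y unfolding N_def using A that by (intro Max_ge) auto
  define b where "b = 1 - p0 ^ N"
  have b: "0 \<le> b" "b < 1" using p0_pos p0_le_1 by (auto simp: b_def power_le_one)
  have 1: "survival A N y \<le> ennreal b * indicator A y" for y
  proof (cases "y \<in> A")
    case True
    have "ennreal (p0 ^ N) \<le> ennreal (p0 ^ gdist G y z)"
      using N[OF True] p0_pos p0_le_1 by (intro ennreal_leI power_decreasing) auto
    also have "\<dots> \<le> hit_prob z (gdist G y z) y" by (rule hit_prob_ge_p0_power)
    also have "\<dots> \<le> hit_prob z N y" by (intro hit_prob_mono N True)
    finally have "ennreal (p0 ^ N) + survival A N y \<le> hit_prob z N y + survival (- {z}) N y"
      using z by (intro add_mono survival_mono) auto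
    also have "\<dots> = ennreal (p0 ^ N) + ennreal b"
      using b p0_pos unfolding hit_prob_add_survival by (simp add: b_def flip: ennreal_plus)
    finally show ?thesis using True by simp
  qed (simp add: survival_outside)
  have 2: "survival A (N + j) x \<le> ennreal b * survival A j x" for j
  proof -
    have "survival A (N + j) x = (killed A ^^ j) (survival A N) x" by (simp add: add.commute[of N] survival_add)
    also have "\<dots> \<le> (killed A ^^ j) (\<lambda>y. ennreal b * indicator A y) x" by (intro killed_pow_mono 1) auto
    finally show ?thesis by (simp add: killed_pow_cmult survival_def)
  qed
  define s where "s j = enn2real (survival A j x)" for j
  have s: "survival A j x = ennreal (s j)" "0 \<le> s j" "s j \<le> 1" for j
    using survival_le_1[of A j x] survival_less_top[of A j x] by (auto simp: s_def enn2real_leI)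
  have sb: "s (N + j) \<le> b * s j" for j using 2[of j] s[of "N + j"] s[of j] b by (simp flip: ennreal_mult)
  \<comment> \<open>Splitting off the first N terms, each at most 1, shows that the partial sum S
    satisfies S \<le> N + b S.\<close>
  have "(\<Sum>j<k. s j) \<le> N / (1 - b)" for k
  proof -
    have "(\<Sum>j<N + k. s j) = (\<Sum>j<N. s j) + (\<Sum>j<k. s (N + j))" by (induction k) auto
    moreover have "(\<Sum>j<N. s j) \<le> N" using sum_bounded_above[of "{..<N}" s 1] s by simp
    moreover have "(\<Sum>j<k. s (N + j)) \<le> b * (\<Sum>j<k. s j)"
      unfolding sum_distrib_left by (intro sum_mono sb)
    moreover have "(\<Sum>j<k. s j) \<le> (\<Sum>j<N + k. s j)" using s by (intro sum_mono2) auto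
    ultimately show ?thesis using b by (simp add: field_simps)
  qed
  then have "(\<Sum>j<k. survival A j x) \<le> ennreal (N / (1 - b))" for k
    using s by (simp add: ennreal_leI)
  then have "expected_exit A x \<le> ennreal (N / (1 - b))" unfolding expected_exit_def by (intro suminf_le_const) auto
  then show ?thesis by (rule le_less_trans) simp
qed

lemma vol_eq: "vol G x R = (\<Sum>y\<in>gball G x R. mu G y)"
  using finite_gball by (simp add: vol_def mu_set_def)

lemma vol_mono: "R \<le> S \<Longrightarrow> vol G x R \<le> vol G x S"
  unfolding vol_eq using mu_pos by (intro sum_mono2 finite_gball) (auto simp: gball_def less_imp_le)

lemma mu_le_vol: "0 < R \<Longrightarrow> mu G x \<le> vol G x R"
  unfolding vol_eq using mu_pos
  by (intro member_le_sum finite_gball) (auto simp: gball_def less_imp_le)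

lemma heat_kernel_nonneg: "0 \<le> heat_kernel G n x y"
  using prob_at_nonneg mu_pos by (simp add: heat_kernel_eq less_imp_le)

lemma heat_kernel_sum_ge: "heat_kernel G n x y \<le> heat_kernel_sum G n x y"
  "heat_kernel G (Suc n) x y \<le> heat_kernel_sum G n x y"
  using heat_kernel_nonneg by (auto simp: heat_kernel_sum_def)

text \<open>One step to a neighbour and back. This serves the diagonal bound at n = 1, which is too
  short for the survival estimate.\<close>

lemma heat_kernel_2_ge: "p0\<^sup>2 / mu G x \<le> heat_kernel G 2 x x"
proof -
  obtain y where y: "adj G x y" using ex_neighbour by blast
  have pr1: "p0 \<le> prob_at 1 u v" if "adj G u v" for u v
  proof -
    have "ennreal p0 \<le> ennreal (trans_prob G u v) * indicator {v} v" using p0_le[OF that] by (simp add: ennreal_leI)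
    also have "\<dots> \<le> ennreal (prob_at 1 u v)" using trans_op_ge[of u v "indicator {v}"] by (simp add: ennreal_prob_at)
    finally show ?thesis using prob_at_nonneg by simp
  qed
  have "p0\<^sup>2 \<le> prob_at 1 x y * prob_at 1 y x" unfolding power2_eq_square
    using p0_pos y by (intro mult_mono pr1 prob_at_nonneg) (auto intro: adj_sym)
  also have "\<dots> \<le> prob_at 2 x x" using sum_prob_at_le[of "{y}" 1 x 1 x] by (simp add: numeral_2_eq_2)
  finally show ?thesis using mu_pos[of x] by (simp add: heat_kernel_eq divide_right_mono)
qed

end

section \<open>Survival in balls and the on-diagonal bound\<close>

locale Ebar_graph = p0_graph +
  fixes C :: real
  assumes C_pos: "0 < C"
    and Ebar: "0 < R \<Longrightarrow> max_mean_exit G x R \<le> ennreal C * mean_exit G x R"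
begin

lemma expected_exit_gball_le:
  assumes "0 < R"
  shows "expected_exit (gball G x R) y \<le> ennreal C * mean_exit G x R"
proof (cases "y \<in> gball G x R")
  case True
  then have "expected_exit (gball G x R) y \<le> max_mean_exit G x R"
    unfolding max_mean_exit_def mean_exit_from_eq by (rule SUP_upper)
  also note Ebar[OF assms]
  finally show ?thesis .
qed (simp add: expected_exit_outside)

text \<open>With E the mean exit time from the centre and s the survival probability, the Markov
  property at time n gives E \<le> n + C E s. Since n \<le> (1 - a) E, dividing by the finite
  positive E leaves a \<le> C s.\<close>

lemma survival_gball_ge:
  assumes R: "0 < R" and n: "ennreal n' \<le> mean_exit G x R" "real n \<le> (1 - a) * n'" "0 < n'" "0 \<le> a"
  shows "ennreal (a / C) \<le> survival (gball G x R) n x"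
proof -
  define E where "E = enn2real (mean_exit G x R)"
  have E: "mean_exit G x R = ennreal E"
    using expected_exit_finite[OF finite_gball, of x R x] by (simp add: E_def mean_exit_eq)
  define s where "s = enn2real (survival (gball G x R) n x)"
  have s: "survival (gball G x R) n x = ennreal s" "0 \<le> s"
    using survival_less_top[of "gball G x R" n x] by (auto simp: s_def)
  have nE: "n' \<le> E" using n unfolding E by (simp add: E_def)
  have "ennreal E \<le> of_nat n + ennreal C * mean_exit G x R * survival (gball G x R) n x"
    using expected_exit_le[OF expected_exit_gball_le[OF R], of x x n] by (simp add: E mean_exit_eq[symmetric])
  also have "\<dots> = ennreal (n + C * E * s)"
    using C_pos nE n s by (simp add: E ennreal_mult ennreal_of_nat_eq_real_of_nat)
  finally have "E \<le> n + C * E * s" using C_pos nE n s by (subst (asm) ennreal_le_iff) auto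
  moreover have "n \<le> (1 - a) * E"
  proof -
    have "0 \<le> (1 - a) * n'" using n(2) by (rule order_trans[rotated]) simp
    then have "0 \<le> 1 - a" using n(3) by (simp add: zero_le_mult_iff)
    then have "(1 - a) * n' \<le> (1 - a) * E" by (intro mult_left_mono nE)
    then show ?thesis using n(2) by simp
  qed
  ultimately have "E * a \<le> E * (C * s)" by (simp add: algebra_simps)
  then have "a \<le> C * s" using nE n(3) by simp
  then show ?thesis using C_pos unfolding s(1) by (intro ennreal_leI) (simp add: field_simps)
qed

lemma on_diagonal_lower_bound:
  "\<exists>c>0. \<forall>x n. c / vol G x (real (inv_exit G x n)) \<le> heat_kernel_sum G n x x"
proof (intro exI conjI allI)
  \<comment> \<open>The three terms serve n = 0, n = 1 and n \<ge> 2; the last is the square of the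
    survival bound with a = 1/3.\<close>
  define c where "c = min (min 1 (p0\<^sup>2)) ((1 / 3 / C)\<^sup>2)"
  show "0 < c" using p0_pos C_pos by (simp add: c_def)
  fix x n
  define R where "R = real (inv_exit G x n)"
  have R: "0 < R" using inv_exit(1)[of x n] by (simp add: R_def)
  have v: "0 < mu G x" "mu G x \<le> vol G x R" using mu_pos mu_le_vol R by auto
  have mu_case: "c / vol G x R \<le> b / mu G x" if "c \<le> b" for b
    using that v \<open>0 < c\<close> by (intro frac_le) auto
  \<comment> \<open>The choice a = 1/3 admits m up to 2n/3. This includes m = n/2 for even n and m =
    (n + 1)/2 for odd n \<ge> 3, where the second summand of \<open>heat_kernel_sum\<close> has the
    even index 2m.\<close>
  have survival_case: "c / vol G x R \<le> heat_kernel G (2 * m) x x" if "3 * m \<le> 2 * n" "0 < n" for m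
  proof -
    have "ennreal (1 / 3 / C) \<le> survival (gball G x R) m x"
      using that inv_exit(2)[of n x] R
      by (intro survival_gball_ge[of _ "real n"]) (auto simp: R_def ennreal_of_nat_eq_real_of_nat)
    moreover have "x \<in> gball G x R" using R by (simp add: gball_def)
    ultimately have "(1 / 3 / C)\<^sup>2 / vol G x R \<le> heat_kernel G (2 * m) x x"
      unfolding vol_eq using C_pos by (intro diagonal_lower_bound finite_gball) auto
    moreover have "c / vol G x R \<le> (1 / 3 / C)\<^sup>2 / vol G x R"
      using v by (intro divide_right_mono) (auto simp: c_def)
    ultimately show ?thesis by simp
  qed
  have "c / vol G x R \<le> heat_kernel_sum G n x x"
  proof -
    consider "n = 0" | "n = 1" | m where "n = 2 * m" "0 < n" | m where "n = 2 * m + 1" "0 < m"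
      by (metis One_nat_def add.commute add_0 evenE mult_0_right neq0_conv oddE)
    then show ?thesis
    proof cases
      case 1
      have "ennreal (prob_at 0 x x) = 1" by (simp add: ennreal_prob_at)
      then have "prob_at 0 x x = 1" by simp
      then have "c / vol G x R \<le> heat_kernel G 0 x x"
        using mu_case[of 1] by (simp add: heat_kernel_eq c_def)
      with 1 show ?thesis using heat_kernel_sum_ge(1)[of 0 x x] by simp
    next
      case 2
      have "c / vol G x R \<le> p0\<^sup>2 / mu G x" by (rule mu_case) (simp add: c_def)
      with 2 show ?thesis using heat_kernel_2_ge[of x] heat_kernel_sum_ge(2)[of 1 x x]
        by (simp add: numeral_2_eq_2)
    next
      case (3 m)
      then show ?thesis using survival_case[of m] heat_kernel_sum_ge(1)[of n x x] by simp
    next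
      case (4 m)
      then show ?thesis using survival_case[of "Suc m"] heat_kernel_sum_ge(2)[of n x x] by simp
    qed
  qed
  then show "c / vol G x (real (inv_exit G x n)) \<le> heat_kernel_sum G n x x" by (simp add: R_def)
qed

section \<open>Chaining along a geodesic\<close>

text \<open>Very strong recurrence gives probability c of hitting z before leaving the ball of
  radius 2r. By Markov's inequality the walk is still in that ball at time k with probability at
  most c/2, so c/2 remains for hitting z by time k.\<close>

lemma hit_prob_step:
  assumes vsr: "\<And>z r w. r \<ge> 1 \<Longrightarrow> w \<in> boundary G (gball G z (real r)) \<Longrightarrow>
      c \<le> measure (rw G w) {\<omega> \<in> space (rw G w). hit_time {z} \<omega> < exit_time (gball G z (2 * real r)) \<omega>}"
    and c: "0 < c"
    and r: "gdist G w z = r" "0 < r" "2 * real r \<le> R"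
    and k: "ennreal C * mean_exit G z R \<le> ennreal (c / 2 * real (Suc k))"
  shows "ennreal (c / 2) \<le> hit_prob z k w"
proof -
  let ?B = "gball G z (2 * real r)"
  have "of_nat (Suc k) * survival ?B k w \<le> expected_exit ?B w" by (rule survival_markov)
  also have "\<dots> \<le> expected_exit (gball G z R) w"
    using r by (intro expected_exit_mono) (auto simp: gball_def)
  \<comment> \<open>The bound on maximal mean exit times passes from the start w to the centre
    z.\<close>
  also have "\<dots> \<le> ennreal (c / 2 * real (Suc k))"
    using expected_exit_gball_le[of R z w] k r by (meson less_le_trans mult_pos_pos of_nat_0_less_iff order_trans zero_less_numeral)
  also have "\<dots> = of_nat (Suc k) * ennreal (c / 2)"
    using c by (simp only: ennreal_of_nat_eq_real_of_nat mult.commute ennreal_mult[symmetric])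
  finally have s: "survival ?B k w \<le> ennreal (c / 2)"
    by (subst (asm) ennreal_mult_le_mult_iff) auto
  have "ennreal (c / 2) + ennreal (c / 2) = ennreal c" using c by (simp flip: ennreal_plus)
  also have "ennreal c \<le> hit_prob z k w + survival ?B k w"
    using r mem_boundary_gball[of w z "r - 1"] by (intro hit_before_exit vsr) auto
  also have "\<dots> \<le> hit_prob z k w + ennreal (c / 2)" by (intro add_left_mono s)
  finally show ?thesis by simp
qed

text \<open>Milestones are placed every r vertices along the geodesic, and the walk goes from each
  to the one before it, starting from milestone j. The minimum caps them at the endpoint y.\<close>

lemma hit_prob_chain_geodesic:
  assumes xs: "walk_betw G x xs y" "length xs = Suc (gdist G x y)"
    and step: "\<And>z w. z \<in> set xs \<Longrightarrow> gdist G w z \<le> r \<Longrightarrow> w \<noteq> z \<Longrightarrow> ennreal a \<le> hit_prob z k w"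
    and a: "0 \<le> a" "a \<le> 1"
  shows "ennreal (a ^ j) \<le> hit_prob x (j * k) (xs ! min (j * r) (gdist G x y))"
proof (induction j)
  case 0
  have "xs ! 0 = x" using xs by (auto simp: walk_betw_def hd_conv_nth)
  then show ?case by simp
next
  case (Suc j)
  define u v where "u = xs ! min (j * r) (gdist G x y)" and "v = xs ! min (Suc j * r) (gdist G x y)"
  have "ennreal a \<le> hit_prob u k v"
  \<comment> \<open>Milestones coincide once the cap is reached; the hitting probability is then 1,
    and \<open>a \<le> 1\<close> suffices.\<close>
  proof (cases "u = v")
    case False
    have "gdist G u v = min (Suc j * r) (gdist G x y) - min (j * r) (gdist G x y)"
      unfolding u_def v_def by (intro geodesic_nth_gdist[OF xs]) auto
    then have "gdist G v u \<le> r" by (simp add: gdist_sym[of v])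
    then show ?thesis using False xs by (intro step) (auto simp: u_def)
  qed (use a in \<open>auto simp: ennreal_le_1\<close>)
  then have "ennreal a * ennreal (a ^ j) \<le> hit_prob u k v * hit_prob x (j * k) u"
    using Suc unfolding u_def by (intro mult_mono) auto
  also have "\<dots> \<le> hit_prob x (k + j * k) v" by (rule hit_prob_chain)
  finally show ?case using a by (simp add: v_def ennreal_mult)
qed

text \<open>With Q = C / c, admissibility says that C times the mean exit time is at most (c/2)(n/l)
  at every vertex of the geodesic, which is the time budget of \<open>hit_prob_step\<close> for each
  of l pieces.\<close>

lemma hit_prob_admissible:
  assumes vsr: "\<And>z r w. r \<ge> 1 \<Longrightarrow> w \<in> boundary G (gball G z (real r)) \<Longrightarrow>
      c \<le> measure (rw G w) {\<omega> \<in> space (rw G w). hit_time {z} \<omega> < exit_time (gball G z (2 * real r)) \<omega>}"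
    and c: "0 < c" "c \<le> 1"
    and l: "l9_admissible G (C / c) x y (1 / 2 * real n) (real (gdist G x y)) l" "l < gdist G x y"
  shows "ennreal ((c / 2) ^ l) \<le> hit_prob x n y"
proof -
  define d where "d = gdist G x y"
  define r where "r = nat \<lceil>d / l\<rceil>"
  define k where "k = n div l"
  have l1: "1 \<le> l" "l < d" using l by (auto simp: l9_admissible_def d_def)
  have "1 < real d / l" using l1 by simp
  then have r: "real r < d / l + 1" "real d / l \<le> r" unfolding r_def by linarith+
  have lr: "d \<le> l * r"
    using r(2) l1 by (simp add: field_simps flip: of_nat_mult)
  \<comment> \<open>As l < d, rounding up gives r < d/l + 1 < 2 d/l, so 2r stays below 9
    d/l.\<close>
  have R: "2 * real r \<le> 9 * real d / real l" using r(1) \<open>1 < real d / l\<close> by simp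
  \<comment> \<open>Rounding k down keeps l k \<le> n; the loss is recovered by the factor
    \<open>Suc k\<close> in Markov's inequality.\<close>
  have k1: "real n / l \<le> Suc k"
  proof -
    have "n < l * Suc k" using l1 by (simp add: k_def dividend_less_times_div)
    then have "real n < real l * real (Suc k)" by (metis of_nat_less_iff of_nat_mult)
    then show ?thesis using l1 by (simp add: field_simps)
  qed
  obtain xs where xs: "walk_betw G x xs y" "length xs = Suc (gdist G x y)" using gdist_walk by blast
  have "ennreal (c / 2) \<le> hit_prob z k w" if z: "z \<in> set xs" and w: "gdist G w z \<le> r" "w \<noteq> z" for z w
  proof (rule hit_prob_step[OF vsr c(1) refl])
    show "0 < gdist G w z" using w by (metis gdist_eq_0_iff gr0I)
    show "2 * real (gdist G w z) \<le> 9 * real d / real l" using R w by (rule_tac order_trans[OF _ R]) simp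
    have "mean_exit G z (9 * real d / real l) \<le> (SUP z\<in>geodesic_hull G x y. mean_exit G z (9 * real (gdist G x y) / l))"
      using z xs unfolding d_def by (intro SUP_upper) (auto simp: geodesic_hull_def)
    then have "ennreal (C / c) * mean_exit G z (9 * real d / real l) \<le> ennreal (1 / 2 * real n / l)"
      using l(1) unfolding l9_admissible_def by (meson mult_left_mono order_trans zero_le)
    then have "ennreal c * (ennreal (C / c) * mean_exit G z (9 * real d / real l)) \<le> ennreal c * ennreal (1 / 2 * real n / l)"
      by (intro mult_left_mono) auto
    also have "ennreal c * (ennreal (C / c) * mean_exit G z (9 * real d / real l)) = ennreal C * mean_exit G z (9 * real d / real l)"
      using c C_pos by (simp add: mult.assoc[symmetric] flip: ennreal_mult)
    also have "ennreal c * ennreal (1 / 2 * real n / l) = ennreal (c / 2 * (real n / l))"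
      using c by (simp flip: ennreal_mult)
    also have "\<dots> \<le> ennreal (c / 2 * real (Suc k))" using k1 c by (intro ennreal_leI mult_left_mono) auto
    finally show "ennreal C * mean_exit G z (9 * real d / real l) \<le> ennreal (c / 2 * real (Suc k))" .
  qed auto
  then have "ennreal ((c / 2) ^ l) \<le> hit_prob x (l * k) (xs ! min (l * r) (gdist G x y))"
    using c by (intro hit_prob_chain_geodesic[OF xs]) auto
  also have "min (l * r) (gdist G x y) = gdist G x y" using lr by (simp add: d_def)
  also have "xs ! gdist G x y = y"
    using xs last_conv_nth[of xs] by (auto simp: walk_betw_def simp del: gdist_eq_0_iff)
  also have "hit_prob x (l * k) y \<le> hit_prob x n y" by (rule hit_prob_mono) (simp add: k_def)
  finally show ?thesis .
qed

end

section \<open>Choice of constants and the two regimes of the chaining length\<close>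

theorem theorem32:
  fixes G :: "'a wgraph"
  assumes "weighted_graph G"
    and "cond_p0 G"
    and "cond_Ebar G"
    and "very_strongly_recurrent G"
  shows "\<exists>Q c C :: real. Q > 0 \<and> c > 0 \<and> C > 0 \<and>
    (\<forall>x y. \<forall>n::nat. n \<ge> gdist G x y \<longrightarrow>
      heat_kernel_sum G n x y \<ge>
        c / vol G x (real (inv_exit G x n)) *
          exp (- C * l9 G Q x y (1 / 2 * real n) (real (gdist G x y))))"
proof -
  obtain p0 where p0: "p0 > 0" "\<And>x y. adj G x y \<Longrightarrow> p0 \<le> trans_prob G x y"
    using assms(2) unfolding cond_p0_def by blast
  obtain C where C: "C > 0" "\<And>x R. R > 0 \<Longrightarrow> max_mean_exit G x R \<le> ennreal C * mean_exit G x R"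
    using assms(3) unfolding cond_Ebar_def by blast
  interpret weighted_graph G by fact
  interpret Ebar_graph G p0 C by unfold_locales (use p0 C in auto)
  obtain c' where c': "c' > 0" "\<And>z r w. (r::nat) \<ge> 1 \<Longrightarrow> w \<in> boundary G (gball G z (real r)) \<Longrightarrow>
      c' \<le> measure (rw G w) {\<omega> \<in> space (rw G w). hit_time {z} \<omega> < exit_time (gball G z (2 * real r)) \<omega>}"
    using assms(4) unfolding very_strongly_recurrent_def by blast
  \<comment> \<open>The cap at 1 makes c/2 less than 1, so its negative logarithm is
    positive.\<close>
  define c where "c = min c' 1"
  have c: "0 < c" "c \<le> 1" using c'(1) by (auto simp: c_def)
  have vsr: "c \<le> measure (rw G w) {\<omega> \<in> space (rw G w). hit_time {z} \<omega> < exit_time (gball G z (2 * real r)) \<omega>}"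
    if "r \<ge> 1" "w \<in> boundary G (gball G z (real r))" for z w and r :: nat
    using c'(2)[OF that] by (simp add: c_def)
  obtain c0 where c0: "0 < c0" "\<And>x n. c0 / vol G x (real (inv_exit G x n)) \<le> heat_kernel_sum G n x x"
    using on_diagonal_lower_bound by blast
  \<comment> \<open>The factor \<open>exp (- K)\<close> lies below both the cost p0 of an edge and
    the cost c/2 of a piece.\<close>
  define K where "K = max (- ln p0) (- ln (c / 2))"
  have K: "0 < K" "exp (- K) \<le> p0" "exp (- K) \<le> c / 2"
  proof -
    have "0 < - ln (c / 2)" using c by (simp add: ln_less_zero)
    then show "0 < K" by (simp add: K_def)
    have "exp (- K) \<le> exp (ln p0)" "exp (- K) \<le> exp (ln (c / 2))" by (auto simp: K_def)
    then show "exp (- K) \<le> p0" "exp (- K) \<le> c / 2" using p0 c by auto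
  qed
  have "c0 / vol G x (real (inv_exit G x n)) * exp (- K * l9 G (C / c) x y (1 / 2 * real n) (real (gdist G x y)))
      \<le> heat_kernel_sum G n x y" if n: "gdist G x y \<le> n" for x y n
  proof -
    define L where "L = l9 G (C / c) x y (1 / 2 * real n) (real (gdist G x y))"
    have "ennreal (exp (- K * L)) \<le> hit_prob x n y"
    proof (cases "real (gdist G x y) \<le> L")
      \<comment> \<open>This covers the default value of \<open>l9\<close> as well as a minimal
        admissible l that is at least the distance; n \<ge> d leaves time to follow the
        edges.\<close>
      case True
      have "exp (- K * L) \<le> exp (- K * gdist G x y)" using True K(1) by simp
      also have "\<dots> = exp (- K) ^ gdist G x y" by (simp add: exp_of_nat_mult[symmetric] mult.commute)
      also have "\<dots> \<le> p0 ^ gdist G x y" using K(2) by (intro power_mono) auto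
      finally have "ennreal (exp (- K * L)) \<le> ennreal (p0 ^ gdist G y x)"
        by (simp add: ennreal_leI gdist_sym[of x y])
      also have "\<dots> \<le> hit_prob x (gdist G y x) y" by (rule hit_prob_ge_p0_power)
      also have "\<dots> \<le> hit_prob x n y" using n by (intro hit_prob_mono) (simp add: gdist_sym[of y])
      finally show ?thesis .
    next
      case False
      define l where "l = (LEAST l. l9_admissible G (C / c) x y (1 / 2 * real n) (real (gdist G x y)) l)"
      \<comment> \<open>The default value of \<open>l9\<close> is the distance itself, so a smaller
        L must come from an admissible integer.\<close>
      from False have ex: "\<exists>l. l9_admissible G (C / c) x y (1 / 2 * real n) (real (gdist G x y)) l"
        by (auto simp: L_def l9_def split: if_splits)
      have L: "L = real l" using ex by (simp add: L_def l9_def l_def)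
      have adm: "l9_admissible G (C / c) x y (1 / 2 * real n) (real (gdist G x y)) l"
        unfolding l_def using ex by (rule LeastI_ex)
      have "exp (- K * L) = exp (- K) ^ l" by (simp add: L exp_of_nat_mult[symmetric] mult.commute)
      also have "\<dots> \<le> (c / 2) ^ l" using K(3) by (intro power_mono) auto
      finally have "ennreal (exp (- K * L)) \<le> ennreal ((c / 2) ^ l)" by (rule ennreal_leI)
      also have "\<dots> \<le> hit_prob x n y"
        using False L by (intro hit_prob_admissible[OF vsr c adm]) auto
      finally show ?thesis .
    qed
    \<comment> \<open>Both \<open>inv_exit\<close> and the volume are monotone, so the diagonal
      bound at time n is the weakest among all k \<le> n.\<close>
    moreover have "c0 / vol G x (real (inv_exit G x n)) \<le> heat_kernel_sum G k x x" if "k \<le> n" for k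
    proof -
      have "0 < vol G x (real (inv_exit G x k))"
        using mu_le_vol[of "real (inv_exit G x k)" x] mu_pos[of x] inv_exit(1)[of x k] by simp
      then have "c0 / vol G x (real (inv_exit G x n)) \<le> c0 / vol G x (real (inv_exit G x k))"
        using inv_exit_mono[OF that, of x] vol_mono[of "real (inv_exit G x k)" "real (inv_exit G x n)" x] c0(1)
        by (intro divide_left_mono mult_pos_pos) auto
      then show ?thesis using c0(2)[of x k] by simp
    qed
    moreover have "0 \<le> c0 / vol G x (real (inv_exit G x n))"
      using c0(1) mu_le_vol[of "real (inv_exit G x n)" x] mu_pos[of x] inv_exit(1)[of x n] by simp
    ultimately have "exp (- K * L) * (c0 / vol G x (real (inv_exit G x n))) \<le> heat_kernel_sum G n x y"
      by (intro heat_kernel_sum_ge_hit_prob) auto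
    then show ?thesis by (simp add: L_def mult.commute)
  qed
  moreover have "0 < C / c" using C(1) c by simp
  ultimately show ?thesis using c0(1) K(1) by blast
qed

end
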